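(* Let $B$ be a Blaschke product with zeros $\{a_n\}$ in a Stolz domain. If $\alpha > -1$ and $0 < p < 1 + \frac{2}{3}\alpha$, then $f' \in A^p_{\alpha}$ for all $f \in (BH^2)^{\perp}$.
   Context: $U$ denotes the open unit disc in $\mathbb{C}$. For $0<p<\infty$ and $\alpha>-1$, $A_\alpha^p$ is the set of all functions $f$ analytic in $U$ with $\|f\|_{A_\alpha^p} = \left\{\frac{1}{\pi}\iint_U |f(z)|^p (1-|z|)^\alpha\, dA(z)\right\}^{1/p} < \infty$, where $dA$ is Lebesgue area measure. If $\{a_n\}_{n\ge 1}$ is a sequence of complex numbers with $0<|a_n|<1$ for all $n$ and $\sum_n (1-|a_n|)<\infty$, the Blaschke product with zeros $\{a_n\}$ is the analytic function on $U$ given by $B(z) = \prod_{n=1}^\infty \frac{\bar a_n}{|a_n|}\frac{a_n - z}{1-\bar a_n z}$. A Stolz domain is a set of the form $\Omega_\eta(\xi) = \{z\in U : |1-\bar\xi z|\le\eta(1-|z|)\}$ for some $\xi\in\partial U$ and some $\eta>1$. $H^2$ is the Hardy space of analytic functions $f$ on $U$ with $\sup_{0<r<1}\left\{\frac{1}{2\pi}\int_0^{2\pi}|f(re^{it})|^2\,dt\right\}^{1/2}<\infty$, with its usual Hilbert space structure. $(BH^2)^\perp = H^2\ominus BH^2$ is the orthogonal complement in $H^2$ of the subspace $BH^2$ (the model space for $B$). *)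

theory Defs
  imports "HOL-Complex_Analysis.Complex_Analysis"
begin

abbreviation unit_disc :: "complex set" where
  "unit_disc \<equiv> ball 0 1"

(* The norm is ((1/pi) * integral) to the power 1/p; since p > 0, it is finite iff
   the quantity below is. *)
definition weighted_bergman :: "real \<Rightarrow> real \<Rightarrow> (complex \<Rightarrow> complex) set" where
  "weighted_bergman p \<alpha> = {f. f holomorphic_on unit_disc \<and>
     ennreal (1 / pi) *
       (\<integral>\<^sup>+z\<in>unit_disc. ennreal (cmod (f z) powr p * (1 - cmod z) powr \<alpha>) \<partial>lborel) < \<infinity>}"

definition blaschke_sequence :: "(nat \<Rightarrow> complex) \<Rightarrow> bool" where
  "blaschke_sequence a \<longleftrightarrow>
     (\<forall>n. 0 < cmod (a n) \<and> cmod (a n) < 1) \<and> summable (\<lambda>n. 1 - cmod (a n))"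

(* prodinf is the has_prod limit, which permits vanishing factors: the value is 0 at
   each zero a n. *)
definition blaschke_product :: "(nat \<Rightarrow> complex) \<Rightarrow> complex \<Rightarrow> complex" where
  "blaschke_product a z =
     prodinf (\<lambda>n. cnj (a n) / complex_of_real (cmod (a n)) * ((a n - z) / (1 - cnj (a n) * z)))"

definition stolz_domain :: "real \<Rightarrow> complex \<Rightarrow> complex set" where
  "stolz_domain \<eta> \<xi> = {z \<in> unit_disc. cmod (1 - cnj \<xi> * z) \<le> \<eta> * (1 - cmod z)}"

definition hardy2 :: "(complex \<Rightarrow> complex) set" where
  "hardy2 = {f. f holomorphic_on unit_disc \<and>
     bdd_above ((\<lambda>r::real.
       sqrt (1 / (2 * pi) * integral {0..2 * pi} (\<lambda>t. (cmod (f (of_real r * cis t)))\<^sup>2)))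
         ` {0<..<1})}"

(* The inner product inducing the H^2 norm: the circle means of |f|^2 increase with r,
   so their supremum is the limit as r tends to 1, and polarisation gives the formula
   below. It equals the inner product of the boundary values in L^2 of the circle. *)
definition hardy2_inner :: "(complex \<Rightarrow> complex) \<Rightarrow> (complex \<Rightarrow> complex) \<Rightarrow> complex" where
  "hardy2_inner f g = Lim (at_left (1::real)) (\<lambda>r.
     complex_of_real (1 / (2 * pi)) *
       integral {0..2 * pi} (\<lambda>t. f (of_real r * cis t) * cnj (g (of_real r * cis t))))"

definition hardy2_multiples :: "(complex \<Rightarrow> complex) \<Rightarrow> (complex \<Rightarrow> complex) set" where
  "hardy2_multiples B = {(\<lambda>z. B z * g z) | g. g \<in> hardy2}"

definition model_space :: "(complex \<Rightarrow> complex) \<Rightarrow> (complex \<Rightarrow> complex) set" where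
  "model_space B = {f \<in> hardy2. \<forall>h \<in> hardy2_multiples B. hardy2_inner f h = 0}"

end

theory Submission
  imports Defs
begin

text \<open>
  Two pointwise bounds on the derivative carry the theorem. For every \<open>f\<close> in the Hardy space,
  \<open>\<bar>f' z\<bar> \<le> C (1 - \<bar>z\<bar>) powr (-3/2)\<close>. For \<open>f\<close> in the model space of a Blaschke product with zeros
  in a Stolz domain with vertex \<open>\<xi>\<close>, moreover \<open>\<bar>f' z\<bar> \<le> C \<bar>\<xi> - z\<bar> powr (-3)\<close>. A geometric mean of
  the two shows that the integrand is at most \<open>C \<bar>\<xi> - z\<bar> powr (-s) * (1 - \<bar>z\<bar>) powr (-u)\<close>, and the condition
  \<open>p < 1 + 2 / 3 * \<alpha>\<close> is what allows both \<open>s < 1\<close> and \<open>u < 1\<close> (\<open>interpolation_exponents\<close>). Such a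
  function is integrable over the disc (\<open>disc_integral_finite\<close>).

  Both bounds come from the reproducing kernel \<open>K z w = (1 - B z * cnj (B w)) / (1 - z * cnj w)\<close> of the
  model space. The increment \<open>f z - f w\<close> is at most the norm of \<open>f\<close> times the norm of the difference of
  the kernels at \<open>z\<close> and \<open>w\<close>, and the square of the latter norm is at most
  \<open>K z z - K z w - K w z + K w w\<close> (\<open>model_space_increment\<close>). Its size, divided by \<open>\<bar>z - w\<bar>\<^sup>2\<close>, bounds
  the derivative (\<open>cmod_deriv_le_of_increment\<close>). The case \<open>B = 0\<close> is the Szego kernel and gives the
  first bound. For a Blaschke product the kernel is the limit of the sums of \<open>e n z * cnj (e n w)\<close> over
  the Takenaka-Malmquist functions \<open>e n\<close>, so the expression is a limit of sums of
  \<open>\<bar>e n z - e n w\<bar>\<^sup>2\<close>. The denominators in \<open>e n\<close> and in the Blaschke factors are comparable to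
  \<open>\<bar>\<xi> - z\<bar>\<close> or larger since the zeros lie in a Stolz domain (\<open>stolz_kernel_lower_bound\<close>), and the
  squares \<open>1 - \<bar>a n\<bar>\<^sup>2\<close> of the normalising factors are summable. This gives the second bound.

  Boundary values on the circle are avoided throughout. Inner products are replaced by means over circles
  of radius \<open>r < 1\<close>, on which the Cauchy formula gives the exact reproducing property
  (\<open>circle_inner_szego\<close>) and \<open>\<bar>B\<bar> \<le> 1\<close> takes the place of the boundary identity \<open>\<bar>B\<bar> = 1\<close>;
  then \<open>r\<close> tends to \<open>1\<close>.
\<close>

section \<open>Integrals over the disc with boundary singularities\<close>

lemma nn_integral_abs_powr_ball:
  fixes c R u :: real
  assumes u: "0 \<le> u" "u < 1" and R: "0 \<le> R"
  shows "(\<integral>\<^sup>+x. ennreal (\<bar>x - c\<bar> powr (-u)) * indicator {c-R..c+R} x \<partial>lborel)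
           \<le> ennreal (2 * R powr (1 - u) / (1 - u))"
proof -
  let ?h = "\<lambda>x::real. ennreal (x powr (-u)) * indicator {0..R} x"
  have h: "(\<integral>\<^sup>+x. ?h x \<partial>lborel) = ennreal (R powr (1 - u) / (1 - u))"
    using nn_integral_has_integral_lebesgue'[OF _ has_integral_powr_from_0[of "-u" R]] u R
    by (simp add: add.commute[of "-u"])
  have [measurable]: "?h \<in> borel_measurable borel" by measurable
  have "(\<integral>\<^sup>+x. ennreal (\<bar>x - c\<bar> powr (-u)) * indicator {c-R..c+R} x \<partial>lborel)
      \<le> (\<integral>\<^sup>+x. ?h (-c + 1 * x) + ?h (c + (-1) * x) \<partial>lborel)"
    by (rule nn_integral_mono) (auto simp: indicator_def abs_if)
  also have "\<dots> = (\<integral>\<^sup>+x. ?h (-c + 1 * x) \<partial>lborel) + (\<integral>\<^sup>+x. ?h (c + (-1) * x) \<partial>lborel)"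
    by (rule nn_integral_add) measurable
  also have "\<dots> = (\<integral>\<^sup>+x. ?h x \<partial>lborel) + (\<integral>\<^sup>+x. ?h x \<partial>lborel)"
    using nn_integral_real_affine[of ?h 1 "-c"] nn_integral_real_affine[of ?h "-1" c] by simp
  also have "\<dots> = ennreal (2 * R powr (1 - u) / (1 - u))"
    unfolding h using u by (simp flip: ennreal_plus)
  finally show ?thesis .
qed

text \<open>With \<open>X = sqrt (1 - y\<^sup>2)\<close> half the length of the slice at height \<open>y\<close>, the distance of a point of
  the slice to the circle is at least \<open>X (X - \<bar>x\<bar>) / 2\<close>, because \<open>1 - \<bar>z\<bar>\<^sup>2 = X\<^sup>2 - x\<^sup>2\<close>. Hence the
  slice integral is at most a constant times \<open>X powr (1 - 2 * u)\<close>, and \<open>1 - 2 * u > -1\<close>. The slices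
  replace polar coordinates.\<close>
lemma disc_slice_integral_le:
  fixes y u :: real
  assumes u: "0 \<le> u" "u < 1" and y: "\<bar>y\<bar> < 1"
  shows "(\<integral>\<^sup>+x. ennreal ((1 - sqrt (x\<^sup>2 + y\<^sup>2)) powr (-u)) * indicator {x. x\<^sup>2 + y\<^sup>2 < 1} x \<partial>lborel)
           \<le> ennreal (16 / (1 - u) * (1 - \<bar>y\<bar>) powr (-(1/2)))"
proof -
  define X where "X = sqrt (1 - y\<^sup>2)"
  have y2: "y\<^sup>2 < 1" using y by (simp add: abs_square_less_1)
  have X: "0 < X" "X \<le> 1" "X\<^sup>2 = 1 - y\<^sup>2" using y2 by (auto simp: X_def)
  \<comment> \<open>balls of radius \<open>2 * X\<close> about the two ends of the slice, so that each contains the slice\<close>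
  have pt: "ennreal ((1 - sqrt (x\<^sup>2 + y\<^sup>2)) powr (-u)) * indicator {x. x\<^sup>2 + y\<^sup>2 < 1} x
     \<le> ennreal (2 * X powr (-u)) * (ennreal (\<bar>x - X\<bar> powr (-u)) * indicator {X-2*X..X+2*X} x
          + ennreal (\<bar>x - (-X)\<bar> powr (-u)) * indicator {-X-2*X..-X+2*X} x)" for x
  proof (cases "x\<^sup>2 + y\<^sup>2 < 1")
    case True
    define \<rho> where "\<rho> = sqrt (x\<^sup>2 + y\<^sup>2)"
    have \<rho>: "0 \<le> \<rho>" "\<rho> < 1" "\<rho>\<^sup>2 = x\<^sup>2 + y\<^sup>2" using True by (auto simp: \<rho>_def)
    have "x\<^sup>2 < X\<^sup>2" using True X by simp
    then have xX: "\<bar>x\<bar> < X" using X by (metis abs_of_pos abs_less_iff power2_abs power2_less_imp_less less_imp_le)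
    have "X * (X - \<bar>x\<bar>) \<le> (X + \<bar>x\<bar>) * (X - \<bar>x\<bar>)" using xX by (intro mult_right_mono) auto
    also have "\<dots> = 1 - \<rho>\<^sup>2" using X \<rho> by (simp add: algebra_simps power2_eq_square)
    also have "\<dots> = (1 - \<rho>) * (1 + \<rho>)" by (simp add: algebra_simps power2_eq_square)
    also have "\<dots> \<le> (1 - \<rho>) * 2" using \<rho> by (intro mult_left_mono) auto
    finally have le: "X * (X - \<bar>x\<bar>) / 2 \<le> 1 - \<rho>" by simp
    have pos: "0 < X * (X - \<bar>x\<bar>) / 2" using xX X by simp
    have "(1 - \<rho>) powr (-u) \<le> (X * (X - \<bar>x\<bar>) / 2) powr (-u)"
      using le pos u by (intro powr_mono2') auto
    also have "\<dots> = X powr (-u) * (X - \<bar>x\<bar>) powr (-u) * 2 powr u"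
      using X xX by (simp add: powr_mult powr_divide powr_minus_divide)
    also have "\<dots> \<le> X powr (-u) * (X - \<bar>x\<bar>) powr (-u) * 2"
      using u powr_mono[of u 1 2] by (intro mult_left_mono) auto
    finally have main: "(1 - \<rho>) powr (-u) \<le> 2 * X powr (-u) * (X - \<bar>x\<bar>) powr (-u)" by (simp add: mult_ac)
    have "(X - \<bar>x\<bar>) powr (-u) \<le> \<bar>x - X\<bar> powr (-u) + \<bar>x - (-X)\<bar> powr (-u)"
      using xX by (cases "x \<ge> 0") (auto simp: abs_if add.commute)
    with main X have "(1 - \<rho>) powr (-u) \<le> 2 * X powr (-u) * (\<bar>x - X\<bar> powr (-u) + \<bar>x - (-X)\<bar> powr (-u))"
      by (smt (verit) mult_left_mono powr_ge_zero mult_nonneg_nonneg)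
    moreover have "x \<in> {X-2*X..X+2*X}" "x \<in> {-X-2*X..-X+2*X}" using xX by auto
    ultimately show ?thesis
      using True by (simp add: \<rho>_def ennreal_mult'[symmetric] ennreal_plus[symmetric] del: ennreal_plus)
  qed auto
  have "(\<integral>\<^sup>+x. ennreal ((1 - sqrt (x\<^sup>2 + y\<^sup>2)) powr (-u)) * indicator {x. x\<^sup>2 + y\<^sup>2 < 1} x \<partial>lborel)
     \<le> (\<integral>\<^sup>+x. ennreal (2 * X powr (-u)) * (ennreal (\<bar>x - X\<bar> powr (-u)) * indicator {X-2*X..X+2*X} x
          + ennreal (\<bar>x - (-X)\<bar> powr (-u)) * indicator {-X-2*X..-X+2*X} x) \<partial>lborel)"
    by (intro nn_integral_mono pt)
  also have "\<dots> = ennreal (2 * X powr (-u)) * ((\<integral>\<^sup>+x. ennreal (\<bar>x - X\<bar> powr (-u)) * indicator {X-2*X..X+2*X} x \<partial>lborel)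
       + (\<integral>\<^sup>+x. ennreal (\<bar>x - (-X)\<bar> powr (-u)) * indicator {-X-2*X..-X+2*X} x \<partial>lborel))"
    by (subst nn_integral_cmult, measurable, subst nn_integral_add, measurable)
  also have "\<dots> \<le> ennreal (2 * X powr (-u)) * (ennreal (2 * (2*X) powr (1 - u) / (1 - u)) + ennreal (2 * (2*X) powr (1 - u) / (1 - u)))"
    by (intro mult_left_mono add_mono nn_integral_abs_powr_ball u) (use X in auto)
  also have "\<dots> = ennreal (2 * X powr (-u) * (2 * (2 * (2*X) powr (1 - u) / (1 - u))))"
    using u by (simp add: ennreal_mult'[symmetric] ennreal_plus[symmetric] del: ennreal_plus)
  also have "\<dots> \<le> ennreal (16 / (1 - u) * (1 - \<bar>y\<bar>) powr (-(1/2)))"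
  proof (rule ennreal_leI)
    have "(2*X) powr (1 - u) = 2 powr (1 - u) * X powr (1 - u)" using X by (simp add: powr_mult)
    also have "\<dots> \<le> 2 * X powr (1 - u)"
      using u powr_mono[of "1-u" 1 2] by (intro mult_right_mono) auto
    finally have "2 * X powr (-u) * (2 * (2 * (2*X) powr (1 - u) / (1 - u)))
       \<le> 2 * X powr (-u) * (2 * (2 * (2 * X powr (1 - u)) / (1 - u)))"
      using u by (intro mult_left_mono divide_right_mono) auto
    also have "\<dots> = 16 / (1 - u) * (X powr (-u) * X powr (1 - u))" by simp
    also have "X powr (-u) * X powr (1 - u) = X powr (1 - 2 * u)" by (simp flip: powr_add)
    also have "X powr (1 - 2 * u) \<le> X powr (-1)"
      using X u by (intro powr_mono') auto
    also have "X powr (-1) = (1 - y\<^sup>2) powr (-(1/2))"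
      using y2 unfolding X_def by (simp add: powr_half_sqrt[symmetric] powr_powr powr_minus_divide)
    also have "\<dots> \<le> (1 - \<bar>y\<bar>) powr (-(1/2))"
    proof (rule powr_mono2')
      have "\<bar>y\<bar> * \<bar>y\<bar> \<le> \<bar>y\<bar>" using mult_left_le[of "\<bar>y\<bar>" "\<bar>y\<bar>"] y by simp
      then show "1 - \<bar>y\<bar> \<le> 1 - y\<^sup>2" by (simp add: power2_eq_square)
    qed (use y in auto)
    finally show "2 * X powr (-u) * (2 * (2 * (2*X) powr (1 - u) / (1 - u)))
       \<le> 16 / (1 - u) * (1 - \<bar>y\<bar>) powr (-(1/2))"
      using u by (simp add: mult_left_mono divide_right_mono)
  qed
  finally show ?thesis .
qed

text \<open>The singularity at \<open>y0\<close> stays away from those at \<open>1\<close> and \<open>-1\<close>, so that each point of the interval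
  is close to at most one of the three and the product is bounded by a sum of one-point singularities.
  Without a bound on \<open>y0\<close> the exponents could add up to more than one.\<close>
lemma interval_singular_integral_finite:
  fixes y0 s :: real
  assumes s: "0 \<le> s" "s < 1" and y0: "\<bar>y0\<bar> \<le> 3/4"
  shows "(\<integral>\<^sup>+y. ennreal (\<bar>y - y0\<bar> powr (-s) * (1 - \<bar>y\<bar>) powr (-(1/2))) * indicator {-1<..<1} y \<partial>lborel) < \<infinity>"
proof -
  let ?k = "\<lambda>v c y. ennreal (\<bar>y - c\<bar> powr (-v)) * indicator {c-2..c+2} (y::real)"
  have pt: "ennreal (\<bar>y - y0\<bar> powr (-s) * (1 - \<bar>y\<bar>) powr (-(1/2))) * indicator {-1<..<1} y
     \<le> 8 * (?k s y0 y + (?k (1/2) 1 y + ?k (1/2) (-1) y))" for y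
  proof (cases "y \<in> {-1<..<1}")
    case True
    then have y: "\<bar>y\<bar> < 1" by auto
    have mem: "y \<in> {y0-2..y0+2}" "y \<in> {1-2..1+2}" "y \<in> {-1-2..-1+2}" using y y0 by auto
    have e: "(1 - \<bar>y\<bar>) powr (-(1/2)) \<le> \<bar>y - 1\<bar> powr (-(1/2)) + \<bar>y - (-1)\<bar> powr (-(1/2))"
      using y by (cases "y \<ge> 0") (auto simp: abs_if add.commute)
    have "\<bar>y - y0\<bar> powr (-s) * (1 - \<bar>y\<bar>) powr (-(1/2))
       \<le> 8 * (\<bar>y - y0\<bar> powr (-s) + (\<bar>y - 1\<bar> powr (-(1/2)) + \<bar>y - (-1)\<bar> powr (-(1/2))))"
    \<comment> \<open>the midpoint \<open>7/8\<close> between \<open>3/4\<close> and \<open>1\<close> leaves distance \<open>1/8\<close> on either side\<close>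
    proof (cases "\<bar>y\<bar> \<le> 7/8")
      case True
      have "(1 - \<bar>y\<bar>) powr (-(1/2)) \<le> (1/8) powr (-(1/2))" using True by (intro powr_mono2') auto
      also have "\<dots> \<le> (1/8) powr (-1::real)" by (intro powr_mono') auto
      also have "\<dots> = 8" by (simp add: powr_minus_divide)
      finally have "\<bar>y - y0\<bar> powr (-s) * (1 - \<bar>y\<bar>) powr (-(1/2)) \<le> \<bar>y - y0\<bar> powr (-s) * 8"
        by (intro mult_left_mono) auto
      then show ?thesis
        using powr_ge_zero[of "\<bar>y - 1\<bar>" "-(1/2)"] powr_ge_zero[of "\<bar>y - (-1)\<bar>" "-(1/2)"] by (simp only: distrib_left)
    next
      case False
      have "1/8 \<le> \<bar>y - y0\<bar>" using False y0 by linarith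
      then have "\<bar>y - y0\<bar> powr (-s) \<le> (1/8) powr (-s)" using s by (intro powr_mono2') auto
      also have "\<dots> \<le> (1/8) powr (-1::real)" using s by (intro powr_mono') auto
      also have "\<dots> = 8" by (simp add: powr_minus_divide)
      finally have "\<bar>y - y0\<bar> powr (-s) * (1 - \<bar>y\<bar>) powr (-(1/2)) \<le> 8 * (1 - \<bar>y\<bar>) powr (-(1/2))"
        by (intro mult_right_mono) auto
      then show ?thesis
        using e powr_ge_zero[of "\<bar>y - y0\<bar>" "-s"] by (simp only: distrib_left)
    qed
    then have "ennreal (\<bar>y - y0\<bar> powr (-s) * (1 - \<bar>y\<bar>) powr (-(1/2)))
      \<le> ennreal (8 * (\<bar>y - y0\<bar> powr (-s) + (\<bar>y - 1\<bar> powr (-(1/2)) + \<bar>y - (-1)\<bar> powr (-(1/2)))))"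
      by (rule ennreal_leI)
    also have "\<dots> = 8 * (ennreal (\<bar>y - y0\<bar> powr (-s)) + (ennreal (\<bar>y - 1\<bar> powr (-(1/2))) + ennreal (\<bar>y - (-1)\<bar> powr (-(1/2)))))"
      by (simp add: ennreal_mult)
    finally show ?thesis using True mem by simp
  qed auto
  have k: "(\<integral>\<^sup>+y. ?k v c y \<partial>lborel) < \<infinity>" if "0 \<le> v" "v < 1" for v c
    using nn_integral_abs_powr_ball[OF that, of 2 c] by (rule le_less_trans) auto
  have "(\<integral>\<^sup>+y. ennreal (\<bar>y - y0\<bar> powr (-s) * (1 - \<bar>y\<bar>) powr (-(1/2))) * indicator {-1<..<1} y \<partial>lborel)
     \<le> (\<integral>\<^sup>+y. 8 * (?k s y0 y + (?k (1/2) 1 y + ?k (1/2) (-1) y)) \<partial>lborel)"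
    by (intro nn_integral_mono pt)
  also have "\<dots> = 8 * ((\<integral>\<^sup>+y. ?k s y0 y \<partial>lborel) + ((\<integral>\<^sup>+y. ?k (1/2) 1 y \<partial>lborel) + (\<integral>\<^sup>+y. ?k (1/2) (-1) y \<partial>lborel)))"
    by (subst nn_integral_cmult, measurable, subst nn_integral_add, measurable, subst nn_integral_add, measurable)
  also have "\<dots> < \<infinity>"
    using k[OF s, of y0] k[of "1/2" 1] k[of "1/2" "-1"] by (simp add: ennreal_mult_less_top)
  finally show ?thesis .
qed

lemma coordinate_disc_integral_finite:
  fixes y0 s u :: real
  assumes s: "0 \<le> s" "s < 1" and u: "0 \<le> u" "u < 1" and y0: "\<bar>y0\<bar> \<le> 3/4"
  shows "(\<integral>\<^sup>+q. ennreal (\<bar>snd q - y0\<bar> powr (-s) * (1 - sqrt ((fst q)\<^sup>2 + (snd q)\<^sup>2)) powr (-u))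
            * indicator {q. (fst q)\<^sup>2 + (snd q)\<^sup>2 < 1} q \<partial>(lborel :: (real \<times> real) measure)) < \<infinity>"
proof -
  let ?F = "\<lambda>q::real\<times>real. ennreal (\<bar>snd q - y0\<bar> powr (-s) * (1 - sqrt ((fst q)\<^sup>2 + (snd q)\<^sup>2)) powr (-u))
            * indicator {q. (fst q)\<^sup>2 + (snd q)\<^sup>2 < 1} q"
  have F[measurable]: "?F \<in> borel_measurable (lborel \<Otimes>\<^sub>M lborel)"
    by measurable
  have "(\<integral>\<^sup>+q. ?F q \<partial>lborel) = (\<integral>\<^sup>+q. ?F q \<partial>(lborel \<Otimes>\<^sub>M lborel))"
    by (simp only: lborel_prod)
  also have "\<dots> = (\<integral>\<^sup>+y. (\<integral>\<^sup>+x. ?F (x, y) \<partial>lborel) \<partial>lborel)"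
    by (rule lborel_pair.nn_integral_snd[symmetric]) (use F in simp)
  also have "\<dots> \<le> (\<integral>\<^sup>+y. ennreal (16 / (1 - u)) *
      (ennreal (\<bar>y - y0\<bar> powr (-s) * (1 - \<bar>y\<bar>) powr (-(1/2))) * indicator {-1<..<1} y) \<partial>lborel)"
  proof (rule nn_integral_mono)
    fix y :: real
    show "(\<integral>\<^sup>+x. ?F (x, y) \<partial>lborel) \<le> ennreal (16 / (1 - u)) *
      (ennreal (\<bar>y - y0\<bar> powr (-s) * (1 - \<bar>y\<bar>) powr (-(1/2))) * indicator {-1<..<1} y)"
    proof (cases "\<bar>y\<bar> < 1")
      case True
      have "(\<integral>\<^sup>+x. ?F (x, y) \<partial>lborel) = (\<integral>\<^sup>+x. ennreal (\<bar>y - y0\<bar> powr (-s)) *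
          (ennreal ((1 - sqrt (x\<^sup>2 + y\<^sup>2)) powr (-u)) * indicator {x. x\<^sup>2 + y\<^sup>2 < 1} x) \<partial>lborel)"
        by (intro nn_integral_cong) (auto simp: ennreal_mult indicator_def)
      also have "\<dots> = ennreal (\<bar>y - y0\<bar> powr (-s)) *
          (\<integral>\<^sup>+x. ennreal ((1 - sqrt (x\<^sup>2 + y\<^sup>2)) powr (-u)) * indicator {x. x\<^sup>2 + y\<^sup>2 < 1} x \<partial>lborel)"
        by (rule nn_integral_cmult) measurable
      also have "\<dots> \<le> ennreal (\<bar>y - y0\<bar> powr (-s)) * ennreal (16 / (1 - u) * (1 - \<bar>y\<bar>) powr (-(1/2)))"
        by (intro mult_left_mono disc_slice_integral_le u True) simp
      also have "\<dots> = ennreal (16 / (1 - u)) * ennreal (\<bar>y - y0\<bar> powr (-s) * (1 - \<bar>y\<bar>) powr (-(1/2)))"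
        using u by (simp add: ennreal_mult'[symmetric] mult_ac)
      finally show ?thesis using True by (simp add: abs_less_iff)
    next
      case False
      then have "1 \<le> y\<^sup>2" using abs_square_less_1[of y] by linarith
      then have "\<not> x\<^sup>2 + y\<^sup>2 < 1" for x using zero_le_power2[of x] by linarith
      then have "(\<integral>\<^sup>+x. ?F (x, y) \<partial>lborel) = (\<integral>\<^sup>+x. 0 \<partial>(lborel :: real measure))"
        by (intro nn_integral_cong) (simp add: indicator_def)
      then show ?thesis by simp
    qed
  qed
  also have "\<dots> = ennreal (16 / (1 - u)) * (\<integral>\<^sup>+y.
      (ennreal (\<bar>y - y0\<bar> powr (-s) * (1 - \<bar>y\<bar>) powr (-(1/2))) * indicator {-1<..<1} y) \<partial>lborel)"
    by (rule nn_integral_cmult) measurable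
  also have "\<dots> < \<infinity>"
    using interval_singular_integral_finite[OF s y0] by (simp add: ennreal_mult_less_top)
  finally show ?thesis .
qed

text \<open>Both ways of reading a pair of reals as a complex number are needed: a point of the unit
  circle has a coordinate of modulus at most \<open>3/4\<close>, and that coordinate has to be the one held fixed
  on each slice.\<close>
lemma lborel_complex_eq_distr:
  "(lborel :: complex measure) = distr (lborel :: (real \<times> real) measure) borel (\<lambda>q. Complex (fst q) (snd q))" (is ?A)
  "(lborel :: complex measure) = distr (lborel :: (real \<times> real) measure) borel (\<lambda>q. Complex (snd q) (fst q))" (is ?B)
proof -
  have meas: "(\<lambda>q. Complex (fst q) (snd q)) \<in> borel_measurable (lborel :: (real \<times> real) measure)"
    "(\<lambda>q. Complex (snd q) (fst q)) \<in> borel_measurable (lborel :: (real \<times> real) measure)"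
    by (auto simp: Complex_eq intro!: borel_measurable_continuous_onI continuous_intros)
  have box: "Complex x y \<in> box l v \<longleftrightarrow> x \<in> box (Re l) (Re v) \<and> y \<in> box (Im l) (Im v)" for x y l v
    by (auto simp: box_def Basis_complex_def)
  show ?A
  proof (rule lborel_eqI)
    fix l v :: complex assume le: "\<And>b. b \<in> Basis \<Longrightarrow> l \<bullet> b \<le> v \<bullet> b"
    have "(\<lambda>q. Complex (fst q) (snd q)) -` box l v = box (Re l) (Re v) \<times> box (Im l) (Im v)"
      by (auto simp: box)
    then show "emeasure (distr lborel borel (\<lambda>q. Complex (fst q) (snd q))) (box l v) = (\<Prod>b\<in>Basis. (v - l) \<bullet> b)"
      using meas(1) le[of 1] le[of \<i>]
      by (simp add: emeasure_distr lborel_prod[symmetric] lborel.emeasure_pair_measure_Times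
          Basis_complex_def ennreal_mult)
  qed simp
  show ?B
  proof (rule lborel_eqI)
    fix l v :: complex assume le: "\<And>b. b \<in> Basis \<Longrightarrow> l \<bullet> b \<le> v \<bullet> b"
    have "(\<lambda>q. Complex (snd q) (fst q)) -` box l v = box (Im l) (Im v) \<times> box (Re l) (Re v)"
      by (auto simp: box)
    then show "emeasure (distr lborel borel (\<lambda>q. Complex (snd q) (fst q))) (box l v) = (\<Prod>b\<in>Basis. (v - l) \<bullet> b)"
      using meas(2) le[of 1] le[of \<i>]
      by (simp add: emeasure_distr lborel_prod[symmetric] lborel.emeasure_pair_measure_Times
          Basis_complex_def ennreal_mult mult.commute)
  qed simp
qed

text \<open>A singularity of order \<open>s < 1\<close> at one boundary point and one of order \<open>u < 1\<close> along the whole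
  circle are jointly integrable: near the boundary point the first depends mostly on the tangential,
  the second on the radial coordinate. The distance to \<open>\<xi>\<close> is bounded below by the distance in a
  single coordinate, after which Tonelli's theorem applies.\<close>
lemma disc_integral_finite:
  fixes \<xi> :: complex and s u :: real
  assumes s: "0 \<le> s" "s < 1" and u: "0 \<le> u" "u < 1" and \<xi>: "cmod \<xi> = 1"
  shows "(\<integral>\<^sup>+z\<in>unit_disc. ennreal (cmod (\<xi> - z) powr (-s) * (1 - cmod z) powr (-u)) \<partial>lborel) < \<infinity>"
proof -
  have dom: "(\<integral>\<^sup>+z\<in>unit_disc. ennreal (cmod (\<xi> - z) powr (-s) * (1 - cmod z) powr (-u)) \<partial>lborel) < \<infinity>"
    if D: "(lborel :: complex measure) = distr (lborel :: (real \<times> real) measure) borel T"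
      and T: "T \<in> borel_measurable (lborel :: (real \<times> real) measure)"
      and n: "\<And>q. cmod (T q) = sqrt ((fst q)\<^sup>2 + (snd q)\<^sup>2)"
      and y0: "\<bar>y0\<bar> \<le> 3/4" and l: "\<And>q. \<bar>snd q - y0\<bar> \<le> cmod (\<xi> - T q)" for T y0
  proof -
    note T[measurable]
    let ?G = "\<lambda>z. ennreal (cmod (\<xi> - z) powr (-s) * (1 - cmod z) powr (-u)) * indicator unit_disc z"
    have [measurable]: "unit_disc \<in> sets borel" by simp
    have "(\<integral>\<^sup>+z. ?G z \<partial>lborel) = (\<integral>\<^sup>+z. ?G z \<partial>(distr (lborel :: (real \<times> real) measure) borel T))"
      by (simp only: D[symmetric])
    also have "\<dots> = (\<integral>\<^sup>+q. ?G (T q) \<partial>lborel)"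
      by (rule nn_integral_distr[OF T]) measurable
    also have "\<dots> \<le> (\<integral>\<^sup>+q. ennreal (\<bar>snd q - y0\<bar> powr (-s) * (1 - sqrt ((fst q)\<^sup>2 + (snd q)\<^sup>2)) powr (-u))
            * indicator {q. (fst q)\<^sup>2 + (snd q)\<^sup>2 < 1} q \<partial>lborel)"
    proof (rule nn_integral_mono_AE)
      \<comment> \<open>the comparison fails on the line \<open>snd q = y0\<close>, where \<open>0 powr (-s)\<close> is \<open>0\<close>\<close>
      have "AE q in (lborel :: (real \<times> real) measure). snd q \<noteq> y0"
      proof (rule AE_I')
        have "(UNIV :: real set) \<times> {y0} \<in> null_sets (lborel \<Otimes>\<^sub>M lborel)"
          by (rule null_setsI) (auto simp: lborel.emeasure_pair_measure_Times)
        then show "(UNIV :: real set) \<times> {y0} \<in> null_sets lborel" by (simp add: lborel_prod)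
      qed auto
      then show "AE q in lborel. ?G (T q) \<le> ennreal (\<bar>snd q - y0\<bar> powr (-s) * (1 - sqrt ((fst q)\<^sup>2 + (snd q)\<^sup>2)) powr (-u))
            * indicator {q. (fst q)\<^sup>2 + (snd q)\<^sup>2 < 1} q"
      proof eventually_elim
        case (elim q)
        have "cmod (\<xi> - T q) powr (-s) \<le> \<bar>snd q - y0\<bar> powr (-s)"
          using elim s l[of q] by (intro powr_mono2') auto
        then show ?case
          by (auto simp: n indicator_def intro!: ennreal_leI mult_right_mono)
      qed
    qed
    also have "\<dots> < \<infinity>" by (rule coordinate_disc_integral_finite[OF s u y0])
    finally show ?thesis .
  qed
  have sq: "(Re \<xi>)\<^sup>2 + (Im \<xi>)\<^sup>2 = 1" using \<xi> by (simp add: cmod_def)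
  have "\<bar>Im \<xi>\<bar> \<le> 3/4 \<or> \<bar>Re \<xi>\<bar> \<le> 3/4"
  proof (rule ccontr)
    assume "\<not> ?thesis"
    then have "(3/4)\<^sup>2 \<le> \<bar>Im \<xi>\<bar>\<^sup>2" "(3/4)\<^sup>2 \<le> \<bar>Re \<xi>\<bar>\<^sup>2" by (intro power_mono; simp)+
    then show False using sq by (simp add: power2_eq_square)
  qed
  then show ?thesis
  proof
    assume y0: "\<bar>Im \<xi>\<bar> \<le> 3/4"
    show ?thesis
      by (rule dom[OF lborel_complex_eq_distr(1) _ _ y0])
         (use abs_Im_le_cmod[of "\<xi> - _"] in \<open>auto simp: cmod_def Complex_eq abs_minus_commute
           intro!: borel_measurable_continuous_onI continuous_intros\<close>)
  next
    assume y0: "\<bar>Re \<xi>\<bar> \<le> 3/4"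
    show ?thesis
      by (rule dom[OF lborel_complex_eq_distr(2) _ _ y0])
         (use abs_Re_le_cmod[of "\<xi> - _"] in \<open>auto simp: cmod_def Complex_eq abs_minus_commute add.commute
           intro!: borel_measurable_continuous_onI continuous_intros\<close>)
  qed
qed

section \<open>Blaschke products and the Takenaka-Malmquist functions\<close>

definition blaschke_factor :: "complex \<Rightarrow> complex \<Rightarrow> complex" where
  "blaschke_factor a z = cnj a / of_real (cmod a) * ((a - z) / (1 - cnj a * z))"

definition blaschke_partial :: "(nat \<Rightarrow> complex) \<Rightarrow> nat \<Rightarrow> complex \<Rightarrow> complex" where
  "blaschke_partial a N z = (\<Prod>n<N. blaschke_factor (a n) z)"

text \<open>The orthonormal basis of the model space that arises from the kernels \<open>1 / (1 - cnj (a n) * z)\<close> by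
  orthogonalisation when the zeros are distinct.\<close>
definition takenaka_malmquist :: "(nat \<Rightarrow> complex) \<Rightarrow> nat \<Rightarrow> complex \<Rightarrow> complex" where
  "takenaka_malmquist a n z =
     of_real (sqrt (1 - (cmod (a n))\<^sup>2)) * blaschke_partial a n z / (1 - cnj (a n) * z)"

lemma of_real_cmod_square: "(complex_of_real (cmod z))\<^sup>2 = z * cnj z"
  by (metis complex_norm_square of_real_power)

lemma one_minus_cnj_mult_nonzero:
  assumes "cmod a < 1" "cmod z < 1"
  shows "1 - cnj a * z \<noteq> 0"
proof
  assume "1 - cnj a * z = 0"
  then have "cmod (cnj a * z) = 1" by (metis eq_iff_diff_eq_0 norm_one)
  moreover have "cmod a * cmod z < 1 * 1"
    by (rule mult_strict_mono') (use assms in auto)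
  ultimately show False by (simp add: norm_mult)
qed

text \<open>This one identity yields both that Blaschke factors are bounded by \<open>1\<close> (take \<open>w = z\<close>) and the
  induction step for the kernel of a finite product.\<close>
lemma blaschke_factor_kernel:
  assumes a: "0 < cmod a" "cmod a < 1" and z: "cmod z < 1" and w: "cmod w < 1"
  shows "1 - blaschke_factor a z * cnj (blaschke_factor a w)
    = of_real (1 - (cmod a)\<^sup>2) * (1 - z * cnj w) / ((1 - cnj a * z) * (1 - a * cnj w))"
proof -
  have nz: "1 - cnj a * z \<noteq> 0" using one_minus_cnj_mult_nonzero a z by blast
  have nw: "1 - a * cnj w \<noteq> 0"
  proof
    assume "1 - a * cnj w = 0"
    then have "cnj (1 - a * cnj w) = 0" by (simp only: complex_cnj_zero)
    then show False using one_minus_cnj_mult_nonzero[of a w] a w by simp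
  qed
  have unit: "cnj a / of_real (cmod a) * cnj (cnj a / of_real (cmod a)) = 1"
    using a by (simp add: complex_norm_square[symmetric] mult.commute[of "cnj a"] power2_eq_square)
  have "blaschke_factor a z * cnj (blaschke_factor a w)
      = (cnj a / of_real (cmod a) * cnj (cnj a / of_real (cmod a))) *
        ((a - z) * (cnj a - cnj w) / ((1 - cnj a * z) * (1 - a * cnj w)))"
    by (simp add: blaschke_factor_def mult_ac)
  also have "\<dots> = (a - z) * (cnj a - cnj w) / ((1 - cnj a * z) * (1 - a * cnj w))"
    by (simp only: unit) simp
  finally have "1 - blaschke_factor a z * cnj (blaschke_factor a w)
      = ((1 - cnj a * z) * (1 - a * cnj w) - (a - z) * (cnj a - cnj w))
          / ((1 - cnj a * z) * (1 - a * cnj w))"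
    using nz nw by (simp add: diff_divide_distrib)
  also have "(1 - cnj a * z) * (1 - a * cnj w) - (a - z) * (cnj a - cnj w)
      = (1 - a * cnj a) * (1 - z * cnj w)"
    by (simp add: algebra_simps)
  finally show ?thesis by (simp add: of_real_cmod_square)
qed

lemma norm_blaschke_factor_le_1:
  assumes a: "0 < cmod a" "cmod a < 1" and z: "cmod z < 1"
  shows "cmod (blaschke_factor a z) \<le> 1"
proof -
  have "complex_of_real (1 - (cmod (blaschke_factor a z))\<^sup>2)
      = of_real (1 - (cmod a)\<^sup>2) * of_real (1 - (cmod z)\<^sup>2)
          / ((1 - cnj a * z) * cnj (1 - cnj a * z))"
    using blaschke_factor_kernel[OF a z z]
    by (simp add: of_real_cmod_square)
  also have "\<dots> = of_real ((1 - (cmod a)\<^sup>2) * (1 - (cmod z)\<^sup>2) / (cmod (1 - cnj a * z))\<^sup>2)"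
    by (simp only: complex_norm_square[symmetric]) simp
  finally have "1 - (cmod (blaschke_factor a z))\<^sup>2
      = (1 - (cmod a)\<^sup>2) * (1 - (cmod z)\<^sup>2) / (cmod (1 - cnj a * z))\<^sup>2"
    by (simp only: of_real_eq_iff)
  also have "\<dots> \<ge> 0"
    using a z by (intro divide_nonneg_nonneg mult_nonneg_nonneg) (simp_all add: power_le_one)
  finally show ?thesis by (simp add: abs_square_le_1)
qed

lemma norm_blaschke_factor_diff:
  assumes a: "0 < cmod a" "cmod a < 1" and z: "cmod z < 1" and w: "cmod w < 1"
  shows "cmod (blaschke_factor a z - blaschke_factor a w)
    = (1 - (cmod a)\<^sup>2) * cmod (z - w) / (cmod (1 - cnj a * z) * cmod (1 - cnj a * w))"
proof -
  have nz: "1 - cnj a * z \<noteq> 0" "1 - cnj a * w \<noteq> 0"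
    using one_minus_cnj_mult_nonzero a z w by blast+
  have "blaschke_factor a z - blaschke_factor a w
     = cnj a / of_real (cmod a) * ((a - z) / (1 - cnj a * z) - (a - w) / (1 - cnj a * w))"
    by (simp add: blaschke_factor_def right_diff_distrib)
  also have "(a - z) / (1 - cnj a * z) - (a - w) / (1 - cnj a * w)
     = ((a - z) * (1 - cnj a * w) - (a - w) * (1 - cnj a * z)) / ((1 - cnj a * z) * (1 - cnj a * w))"
    using nz by (simp add: diff_frac_eq)
  also have "(a - z) * (1 - cnj a * w) - (a - w) * (1 - cnj a * z) = (1 - a * cnj a) * (w - z)"
    by (simp add: algebra_simps)
  also have "1 - a * cnj a = of_real (1 - (cmod a)\<^sup>2)"
    by (simp add: of_real_cmod_square)
  also have "cmod (cnj a / of_real (cmod a) *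
      (of_real (1 - (cmod a)\<^sup>2) * (w - z) / ((1 - cnj a * z) * (1 - cnj a * w))))
      = (1 - (cmod a)\<^sup>2) * cmod (z - w) / (cmod (1 - cnj a * z) * cmod (1 - cnj a * w))"
    using a by (simp only: norm_mult norm_divide norm_of_real norm_minus_commute[of w z])
      (simp add: power_le_one)
  finally show ?thesis .
qed

lemma norm_one_minus_cnj_mult_ge:
  assumes "cmod a \<le> 1"
  shows "1 - cmod z \<le> cmod (1 - cnj a * z)"
proof -
  have "cmod (cnj a * z) \<le> cmod z" using assms by (simp add: norm_mult mult_left_le_one_le)
  then show ?thesis using norm_triangle_ineq2[of 1 "cnj a * z"] by simp
qed

lemma norm_blaschke_factor_minus_1:
  assumes a: "0 < cmod a" "cmod a < 1" and z: "cmod z < 1"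
  shows "cmod (blaschke_factor a z - 1) \<le> (1 - cmod a) * (2 / (1 - cmod z))"
proof -
  have nz: "1 - cnj a * z \<noteq> 0" using one_minus_cnj_mult_nonzero a z by blast
  have "1 - blaschke_factor a z
      = (of_real (cmod a) * (1 - cnj a * z) - cnj a * (a - z)) / (of_real (cmod a) * (1 - cnj a * z))"
    using nz a by (auto simp: blaschke_factor_def field_simps)
  also have "of_real (cmod a) * (1 - cnj a * z) - cnj a * (a - z)
      = of_real (cmod a) * (1 - cnj a * z) - (of_real ((cmod a)\<^sup>2) - cnj a * z)"
    by (simp add: of_real_cmod_square algebra_simps)
  also have "\<dots> = of_real (1 - cmod a) * (of_real (cmod a) + cnj a * z)"
    by (simp add: algebra_simps power2_eq_square)
  finally have eq: "cmod (blaschke_factor a z - 1)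
      = (1 - cmod a) * (cmod (of_real (cmod a) + cnj a * z) / (cmod a * cmod (1 - cnj a * z)))"
    using a by (subst norm_minus_commute) (simp only: norm_mult norm_divide norm_of_real, simp)
  have num: "cmod (of_real (cmod a) + cnj a * z) \<le> cmod a * 2"
  proof -
    have "cmod (of_real (cmod a) + cnj a * z) \<le> cmod a + cmod a * cmod z"
      using norm_triangle_ineq[of "of_real (cmod a)" "cnj a * z"] by (simp add: norm_mult)
    also have "cmod a * cmod z \<le> cmod a" using a z by (simp add: mult_left_le)
    finally show ?thesis by simp
  qed
  have "cmod (of_real (cmod a) + cnj a * z) / (cmod a * cmod (1 - cnj a * z))
      \<le> cmod a * 2 / (cmod a * (1 - cmod z))"
    by (rule frac_le) (use num a z norm_one_minus_cnj_mult_ge[of a z] in auto)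
  then show ?thesis unfolding eq using a by (intro mult_left_mono) auto
qed

lemma blaschke_factor_holomorphic:
  assumes "0 < cmod a" "cmod a < 1"
  shows "blaschke_factor a holomorphic_on unit_disc"
  unfolding blaschke_factor_def[abs_def]
  using assms one_minus_cnj_mult_nonzero[of a] by (auto intro!: holomorphic_intros)

lemma norm_blaschke_partial_le_1:
  assumes "\<And>n. 0 < cmod (a n)" "\<And>n. cmod (a n) < 1" "cmod z < 1"
  shows "cmod (blaschke_partial a N z) \<le> 1"
  unfolding blaschke_partial_def
  by (simp add: prod_norm[symmetric]) (intro prod_le_1, use assms norm_blaschke_factor_le_1 in auto)

text \<open>The expansion of the reproducing kernel in the basis, obtained by telescoping:
  \<open>1 - P b cnj (P' b') = (1 - P cnj P') + P cnj P' (1 - b cnj b')\<close>.\<close>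
lemma blaschke_partial_kernel:
  assumes a: "\<And>n. 0 < cmod (a n)" "\<And>n. cmod (a n) < 1" and z: "cmod z < 1" and w: "cmod w < 1"
  shows "1 - blaschke_partial a N z * cnj (blaschke_partial a N w)
    = (1 - z * cnj w) * (\<Sum>n<N. takenaka_malmquist a n z * cnj (takenaka_malmquist a n w))"
proof (induction N)
  case 0
  then show ?case by (simp add: blaschke_partial_def)
next
  case (Suc N)
  let ?P = "blaschke_partial a N z * cnj (blaschke_partial a N w)"
  let ?b = "blaschke_factor (a N) z * cnj (blaschke_factor (a N) w)"
  have sq: "complex_of_real (sqrt (1 - (cmod (a N))\<^sup>2)) * of_real (sqrt (1 - (cmod (a N))\<^sup>2))
      = of_real (1 - (cmod (a N))\<^sup>2)"
    using a(2)[of N] by (simp add: power_le_one flip: of_real_mult)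
  have "takenaka_malmquist a N z * cnj (takenaka_malmquist a N w)
      = (complex_of_real (sqrt (1 - (cmod (a N))\<^sup>2)) * of_real (sqrt (1 - (cmod (a N))\<^sup>2)))
        * ?P / ((1 - cnj (a N) * z) * (1 - a N * cnj w))"
    by (simp add: takenaka_malmquist_def)
  then have "(1 - z * cnj w) * (takenaka_malmquist a N z * cnj (takenaka_malmquist a N w))
      = ?P * (of_real (1 - (cmod (a N))\<^sup>2) * (1 - z * cnj w) / ((1 - cnj (a N) * z) * (1 - a N * cnj w)))"
    unfolding sq by (simp add: mult_ac)
  also have "\<dots> = ?P * (1 - ?b)"
    by (simp only: blaschke_factor_kernel[OF a z w])
  finally have stp: "(1 - z * cnj w) * (takenaka_malmquist a N z * cnj (takenaka_malmquist a N w))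
      = ?P * (1 - ?b)" .
  have "1 - blaschke_partial a (Suc N) z * cnj (blaschke_partial a (Suc N) w)
      = (1 - ?P) + ?P * (1 - ?b)"
    by (simp add: blaschke_partial_def algebra_simps)
  also have "\<dots> = (1 - z * cnj w) * (\<Sum>n<Suc N. takenaka_malmquist a n z * cnj (takenaka_malmquist a n w))"
    unfolding Suc.IH stp[symmetric] by (simp add: algebra_simps)
  finally show ?case .
qed

lemma blaschke_product_eq_prodinf: "blaschke_product a z = (\<Prod>n. blaschke_factor (a n) z)"
  by (simp add: blaschke_product_def blaschke_factor_def)

text \<open>On a smaller disc the factors differ from \<open>1\<close> by at most a constant times \<open>1 - \<bar>a n\<bar>\<close>, which is
  summable. The identification of the limit with the infinite product is valid at the zeros too,
  since absolute convergence permits finitely many vanishing factors.\<close>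
lemma blaschke_partial_uniform_limit:
  assumes a: "blaschke_sequence a" and \<rho>: "\<rho> < 1"
  shows "uniform_limit (cball 0 \<rho>) (blaschke_partial a) (blaschke_product a) sequentially"
proof -
  have a': "0 < cmod (a n)" "cmod (a n) < 1" for n
    using a by (auto simp: blaschke_sequence_def)
  have s: "summable (\<lambda>n. 1 - cmod (a n))"
    using a by (auto simp: blaschke_sequence_def)
  have "uniformly_convergent_on (cball 0 \<rho>) (\<lambda>N z. \<Prod>n<N. blaschke_factor (a n) z)"
  proof (rule uniformly_convergent_on_prod')
    show "continuous_on (cball 0 \<rho>) (blaschke_factor (a n))" for n
      by (rule continuous_on_subset[OF holomorphic_on_imp_continuous_on[OF blaschke_factor_holomorphic[OF a']]])
         (use \<rho> in auto)
    show "uniformly_convergent_on (cball 0 \<rho>) (\<lambda>N z. \<Sum>n<N. cmod (blaschke_factor (a n) z - 1))"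
    proof (rule Weierstrass_m_test')
      show "norm (cmod (blaschke_factor (a n) z - 1)) \<le> (1 - cmod (a n)) * (2 / (1 - \<rho>))"
        if "z \<in> cball 0 \<rho>" for n z
      proof -
        have z: "cmod z \<le> \<rho>" using that by simp
        have "cmod (blaschke_factor (a n) z - 1) \<le> (1 - cmod (a n)) * (2 / (1 - cmod z))"
          using norm_blaschke_factor_minus_1[OF a'] z \<rho> by auto
        also have "\<dots> \<le> (1 - cmod (a n)) * (2 / (1 - \<rho>))"
          using z \<rho> less_imp_le[OF a'(2)[of n]] by (intro mult_left_mono frac_le) auto
        finally show ?thesis by simp
      qed
      show "summable (\<lambda>n. (1 - cmod (a n)) * (2 / (1 - \<rho>)))"
        by (intro summable_mult2 s)
    qed
  qed auto
  then obtain l where l: "uniform_limit (cball 0 \<rho>) (blaschke_partial a) l sequentially"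
    by (auto simp: uniformly_convergent_on_def blaschke_partial_def[abs_def])
  have "l z = blaschke_product a z" if z: "z \<in> cball 0 \<rho>" for z
  proof -
    have "summable (\<lambda>n. norm (blaschke_factor (a n) z - 1))"
    proof (rule summable_comparison_test')
      show "summable (\<lambda>n. (1 - cmod (a n)) * (2 / (1 - cmod z)))"
        by (intro summable_mult2 s)
      show "norm (norm (blaschke_factor (a n) z - 1)) \<le> (1 - cmod (a n)) * (2 / (1 - cmod z))" for n
        using norm_blaschke_factor_minus_1[OF a', of z n] z \<rho> by simp
    qed
    then have "convergent_prod (\<lambda>n. blaschke_factor (a n) z)"
      by (intro abs_convergent_prod_imp_convergent_prod summable_imp_abs_convergent_prod)
    from convergent_prod_LIMSEQ[OF this]
    have "(\<lambda>N. blaschke_partial a N z) \<longlonglongrightarrow> blaschke_product a z"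
      unfolding blaschke_partial_def blaschke_product_eq_prodinf LIMSEQ_lessThan_iff_atMost .
    moreover have "(\<lambda>N. blaschke_partial a N z) \<longlonglongrightarrow> l z"
      by (rule tendsto_uniform_limitI[OF l z])
    ultimately show ?thesis by (rule LIMSEQ_unique[symmetric])
  qed
  then show ?thesis using l by (metis (no_types, lifting) uniform_limit_cong')
qed

lemma blaschke_partial_tendsto:
  assumes "blaschke_sequence a" "cmod z < 1"
  shows "(\<lambda>N. blaschke_partial a N z) \<longlonglongrightarrow> blaschke_product a z"
  by (rule tendsto_uniform_limitI[OF blaschke_partial_uniform_limit[OF assms]]) simp

lemma norm_blaschke_product_le_1:
  assumes "blaschke_sequence a" "cmod z < 1"
  shows "cmod (blaschke_product a z) \<le> 1"
proof (rule tendsto_upperbound[OF tendsto_norm[OF blaschke_partial_tendsto[OF assms]]])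
  show "\<forall>\<^sub>F N in sequentially. cmod (blaschke_partial a N z) \<le> 1"
    using assms by (intro always_eventually allI norm_blaschke_partial_le_1) (auto simp: blaschke_sequence_def)
qed simp

lemma blaschke_product_holomorphic:
  assumes a: "blaschke_sequence a"
  shows "blaschke_product a holomorphic_on unit_disc"
proof (rule holomorphic_uniform_sequence[where f = "blaschke_partial a"])
  show "blaschke_partial a N holomorphic_on unit_disc" for N
    unfolding blaschke_partial_def[abs_def]
    using a by (intro holomorphic_intros blaschke_factor_holomorphic) (auto simp: blaschke_sequence_def)
  show "\<exists>d>0. cball z d \<subseteq> unit_disc \<and>
      uniform_limit (cball z d) (blaschke_partial a) (blaschke_product a) sequentially"
    if z: "z \<in> unit_disc" for z
  proof -
    define d where "d = (1 - cmod z) / 2"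
    have d: "d > 0" "cmod z + d < 1" using z by (auto simp: d_def field_simps)
    have sub: "cball z d \<subseteq> cball 0 (cmod z + d)"
    proof
      fix w assume "w \<in> cball z d"
      then show "w \<in> cball 0 (cmod z + d)"
        using norm_triangle_ineq[of z "w - z"] by (simp add: dist_norm norm_minus_commute)
    qed
    moreover have "cball 0 (cmod z + d) \<subseteq> unit_disc" using d by auto
    ultimately show ?thesis
      using d uniform_limit_on_subset[OF blaschke_partial_uniform_limit[OF a d(2)] sub] by blast
  qed
qed simp

lemma blaschke_sequence_square_summable:
  assumes a: "blaschke_sequence a"
  shows "summable (\<lambda>n. 1 - (cmod (a n))\<^sup>2)"
proof (rule summable_comparison_test')
  show "summable (\<lambda>n. 2 * (1 - cmod (a n)))"
    using a by (intro summable_mult) (auto simp: blaschke_sequence_def)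
  show "norm (1 - (cmod (a n))\<^sup>2) \<le> 2 * (1 - cmod (a n))" for n
  proof -
    have "(cmod (a n))\<^sup>2 \<le> 1"
      using a by (simp add: blaschke_sequence_def power_le_one less_imp_le)
    then show ?thesis using sum_squares_bound[of 1 "cmod (a n)"] by simp
  qed
qed

text \<open>The difference quotient of a basis function is controlled by lower bounds \<open>s\<close> and \<open>t\<close> for the
  denominators alone: the difference quotients of the Blaschke factors are at most
  \<open>(1 - \<bar>a n\<bar>\<^sup>2) / (s * t)\<close>, and these bounds sum to \<open>S / (s * t)\<close> for the partial product. Working with difference quotients rather than derivatives makes the estimate
  pass to the infinite product by pointwise convergence.\<close>
lemma norm_takenaka_malmquist_diff:
  assumes a: "blaschke_sequence a" and z: "cmod z < 1" and w: "cmod w < 1"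
    and s: "0 < s" "\<And>n. s \<le> cmod (1 - cnj (a n) * z)"
    and t: "0 < t" "\<And>n. t \<le> cmod (1 - cnj (a n) * w)"
  defines "S \<equiv> (\<Sum>n. 1 - (cmod (a n))\<^sup>2)"
  shows "cmod (takenaka_malmquist a n z - takenaka_malmquist a n w)
     \<le> sqrt (1 - (cmod (a n))\<^sup>2) * (cmod (z - w) * (S / (s\<^sup>2 * t) + 1 / (s * t)))"
proof -
  have a': "0 < cmod (a n)" "cmod (a n) < 1" for n
    using a by (auto simp: blaschke_sequence_def)
  have nn: "0 \<le> 1 - (cmod (a n))\<^sup>2" for n using a'(2)[of n] by (simp add: power_le_one)
  have summ: "summable (\<lambda>n. 1 - (cmod (a n))\<^sup>2)"
    by (rule blaschke_sequence_square_summable[OF a])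
  have st: "s * t > 0" using s t by simp
  have "cmod (blaschke_partial a n z - blaschke_partial a n w)
      \<le> (\<Sum>k<n. cmod (blaschke_factor (a k) z - blaschke_factor (a k) w))"
    unfolding blaschke_partial_def
    by (rule norm_prod_diff) (use norm_blaschke_factor_le_1 a' z w in auto)
  also have "\<dots> \<le> (\<Sum>k<n. (1 - (cmod (a k))\<^sup>2) * (cmod (z - w) / (s * t)))"
  proof (rule sum_mono)
    fix k
    have "(1 - (cmod (a k))\<^sup>2) * cmod (z - w) / (cmod (1 - cnj (a k) * z) * cmod (1 - cnj (a k) * w))
       \<le> (1 - (cmod (a k))\<^sup>2) * cmod (z - w) / (s * t)"
      using nn s t by (intro frac_le mult_mono mult_nonneg_nonneg) (auto intro: order_trans[OF less_imp_le])
    then show "cmod (blaschke_factor (a k) z - blaschke_factor (a k) w)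
        \<le> (1 - (cmod (a k))\<^sup>2) * (cmod (z - w) / (s * t))"
      by (simp add: norm_blaschke_factor_diff[OF a' z w])
  qed
  also have "\<dots> = (\<Sum>k<n. 1 - (cmod (a k))\<^sup>2) * (cmod (z - w) / (s * t))"
    by (simp only: sum_distrib_right)
  also have "\<dots> \<le> S * (cmod (z - w) / (s * t))"
    unfolding S_def using st
    by (intro mult_right_mono sum_le_suminf summ nn) auto
  finally have P: "cmod (blaschke_partial a n z - blaschke_partial a n w) \<le> S * (cmod (z - w) / (s * t))" .
  have S0: "S \<ge> 0" unfolding S_def by (intro suminf_nonneg summ nn)
  have nz: "1 - cnj (a n) * z \<noteq> 0" "1 - cnj (a n) * w \<noteq> 0"
    using one_minus_cnj_mult_nonzero a' z w by blast+
  let ?P = "blaschke_partial a n"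
  have split: "?P z / (1 - cnj (a n) * z) - ?P w / (1 - cnj (a n) * w)
     = (?P z - ?P w) / (1 - cnj (a n) * z)
       + ?P w * (cnj (a n) * (z - w) / ((1 - cnj (a n) * z) * (1 - cnj (a n) * w)))"
    using nz by (simp add: divide_simps) (simp add: algebra_simps)
  have 1: "cmod ((?P z - ?P w) / (1 - cnj (a n) * z)) \<le> cmod (z - w) * (S / (s\<^sup>2 * t))"
  proof -
    have "cmod ((?P z - ?P w) / (1 - cnj (a n) * z)) \<le> S * (cmod (z - w) / (s * t)) / s"
      unfolding norm_divide by (rule frac_le) (use P s S0 st in auto)
    also have "\<dots> = cmod (z - w) * (S / (s\<^sup>2 * t))" by (simp add: power2_eq_square mult_ac)
    finally show ?thesis .
  qed
  have 2: "cmod (?P w * (cnj (a n) * (z - w) / ((1 - cnj (a n) * z) * (1 - cnj (a n) * w))))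
      \<le> cmod (z - w) * (1 / (s * t))"
  proof -
    have "cmod (cnj (a n) * (z - w) / ((1 - cnj (a n) * z) * (1 - cnj (a n) * w)))
       \<le> cmod (z - w) / (s * t)"
      unfolding norm_divide norm_mult
      using s t less_imp_le[OF a'(2)[of n]] st
      by (intro frac_le mult_mono) (auto simp: mult_left_le_one_le intro: order_trans[OF less_imp_le])
    moreover have "cmod (?P w) \<le> 1" using norm_blaschke_partial_le_1[OF a' w] .
    ultimately have "cmod (?P w) * cmod (cnj (a n) * (z - w) / ((1 - cnj (a n) * z) * (1 - cnj (a n) * w)))
       \<le> 1 * (cmod (z - w) / (s * t))"
      by (intro mult_mono) auto
    then show ?thesis unfolding norm_mult[of "?P w"] by simp
  qed
  have "takenaka_malmquist a n z - takenaka_malmquist a n w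
      = of_real (sqrt (1 - (cmod (a n))\<^sup>2)) * (?P z / (1 - cnj (a n) * z) - ?P w / (1 - cnj (a n) * w))"
    by (simp add: takenaka_malmquist_def right_diff_distrib)
  then have "cmod (takenaka_malmquist a n z - takenaka_malmquist a n w)
      = sqrt (1 - (cmod (a n))\<^sup>2) * cmod (?P z / (1 - cnj (a n) * z) - ?P w / (1 - cnj (a n) * w))"
    using nn by (simp add: norm_mult)
  also have "\<dots> \<le> sqrt (1 - (cmod (a n))\<^sup>2) * (cmod (z - w) * (S / (s\<^sup>2 * t)) + cmod (z - w) * (1 / (s * t)))"
    unfolding split using nn
    by (intro mult_left_mono order_trans[OF norm_triangle_ineq] add_mono 1 2) simp
  finally show ?thesis by (simp only: distrib_left)
qed

section \<open>Circle means and the inner product of the Hardy space\<close>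

definition circle_inner :: "real \<Rightarrow> (complex \<Rightarrow> complex) \<Rightarrow> (complex \<Rightarrow> complex) \<Rightarrow> complex" where
  "circle_inner r f g = complex_of_real (1 / (2 * pi)) *
     integral {0..2 * pi} (\<lambda>t. f (of_real r * cis t) * cnj (g (of_real r * cis t)))"

definition szego :: "complex \<Rightarrow> complex \<Rightarrow> complex" where
  "szego z w = 1 / (1 - cnj z * w)"

definition taylor :: "(complex \<Rightarrow> complex) \<Rightarrow> nat \<Rightarrow> complex" where
  "taylor f n = (deriv ^^ n) f 0 / fact n"

lemma circle_in_unit_disc: "0 < r \<Longrightarrow> r < 1 \<Longrightarrow> complex_of_real r * cis t \<in> unit_disc"
  by (simp add: norm_mult)

lemma continuous_on_circle:
  assumes "continuous_on unit_disc f" "0 < r" "r < 1"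
  shows "continuous_on S (\<lambda>t. f (complex_of_real r * cis t))"
  by (rule continuous_on_compose2[OF assms(1)])
     (use circle_in_unit_disc[OF assms(2,3)] in \<open>auto intro!: continuous_intros\<close>)

lemma has_integral_of_circlepath:
  assumes "(h has_contour_integral 2 * of_real pi * \<i> * J) (circlepath 0 r)"
  shows "((\<lambda>t. h (of_real r * cis t) * (of_real r * cis t)) has_integral 2 * of_real pi * J) {0..2 * pi}"
proof -
  have "((\<lambda>t. h (0 + r * cis t) * r * \<i> * cis t) has_integral 2 * of_real pi * \<i> * J) {0..2*pi}"
    using assms unfolding circlepath_def
    by (subst (asm) has_contour_integral_part_circlepath_iff) auto
  from has_integral_mult_right[OF this, of "- \<i>"] show ?thesis
    by (simp add: algebra_simps)
qed

lemma cnj_on_circle: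
  assumes "0 < r" "\<zeta> = of_real r * cis t"
  shows "cnj \<zeta> = of_real (r\<^sup>2) / \<zeta>" "\<zeta> \<noteq> 0"
proof -
  show "\<zeta> \<noteq> 0" using assms by auto
  have "cmod \<zeta> = r" using assms by (simp add: norm_mult)
  then have "\<zeta> * cnj \<zeta> = of_real (r\<^sup>2)" by (metis complex_norm_square)
  then show "cnj \<zeta> = of_real (r\<^sup>2) / \<zeta>" using \<open>\<zeta> \<noteq> 0\<close> by (simp add: field_simps)
qed

text \<open>The reproducing property on a circle inside the disc. There \<open>cnj \<zeta> = r\<^sup>2 / \<zeta>\<close>, so the conjugate of
  the Szego kernel turns into a Cauchy kernel with pole at \<open>r\<^sup>2 z\<close>.\<close>
lemma circle_inner_szego:
  assumes f: "f holomorphic_on unit_disc" and r: "0 < r" "r < 1" and z: "cmod z < 1"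
  shows "circle_inner r f (szego z) = f (of_real (r\<^sup>2) * z)"
proof -
  let ?w = "of_real (r\<^sup>2) * z"
  have "cmod ?w \<le> r * cmod z"
    using r z by (simp add: norm_mult power2_eq_square mult_left_le_one_le mult_right_mono)
  also have "\<dots> < r" using r z by (simp add: mult_less_cancel_left2)
  finally have w: "cmod (?w - 0) < r" by simp
  have hol: "f holomorphic_on cball 0 r"
    using r by (intro holomorphic_on_subset[OF f]) auto
  have "((\<lambda>t. f (of_real r * cis t) / (of_real r * cis t - ?w) * (of_real r * cis t))
          has_integral 2 * of_real pi * f ?w) {0..2 * pi}"
    by (rule has_integral_of_circlepath[OF Cauchy_integral_circlepath_simple[OF hol w]])
  moreover have "f (of_real r * cis t) / (of_real r * cis t - ?w) * (of_real r * cis t)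
      = f (of_real r * cis t) * cnj (szego z (of_real r * cis t))" for t
  proof -
    define \<zeta> where "\<zeta> = of_real r * cis t"
    note c = cnj_on_circle[OF r(1) \<zeta>_def]
    have "cmod \<zeta> = r" using r by (simp add: \<zeta>_def norm_mult)
    then have "\<zeta> \<noteq> ?w" using w by auto
    have "cnj (szego z \<zeta>) = 1 / (1 - z * (of_real (r\<^sup>2) / \<zeta>))"
      by (simp only: szego_def c(1) complex_cnj_divide complex_cnj_one complex_cnj_diff
          complex_cnj_mult complex_cnj_cnj)
    also have "1 - z * (of_real (r\<^sup>2) / \<zeta>) = (\<zeta> - ?w) / \<zeta>"
      using c(2) by (simp add: field_simps)
    finally have "cnj (szego z \<zeta>) = \<zeta> / (\<zeta> - ?w)" by simp
    then show ?thesis by (simp add: \<zeta>_def)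
  qed
  ultimately have "((\<lambda>t. f (of_real r * cis t) * cnj (szego z (of_real r * cis t)))
          has_integral (2 * of_real pi * f ?w)) {0..2 * pi}"
    by simp
  then show ?thesis
    unfolding circle_inner_def by (simp add: integral_unique)
qed

lemma circle_inner_monomial:
  assumes f: "f holomorphic_on unit_disc" and r: "0 < r" "r < 1"
  shows "((\<lambda>t. f (of_real r * cis t) * cnj ((of_real r * cis t) ^ n))
           has_integral 2 * of_real pi * of_real (r ^ (2 * n)) * taylor f n) {0..2 * pi}"
proof -
  have hol: "f holomorphic_on cball 0 r"
    using r by (intro holomorphic_on_subset[OF f]) auto
  have "((\<lambda>u. f u / (u - 0) ^ Suc n) has_contour_integral
          (2 * pi * \<i>) / (fact n) * (deriv ^^ n) f 0) (circlepath 0 r)"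
    by (rule Cauchy_has_contour_integral_higher_derivative_circlepath)
       (use hol r in \<open>auto intro: holomorphic_on_imp_continuous_on holomorphic_on_subset\<close>)
  then have "((\<lambda>u. f u / u ^ Suc n) has_contour_integral 2 * of_real pi * \<i> * taylor f n) (circlepath 0 r)"
    by (simp add: taylor_def)
  note this[THEN has_integral_of_circlepath]
  from has_integral_mult_right[OF this, of "of_real (r ^ (2 * n))"]
  have 1: "((\<lambda>t. of_real (r ^ (2 * n)) * (f (of_real r * cis t) / (of_real r * cis t) ^ Suc n * (of_real r * cis t)))
          has_integral 2 * of_real pi * of_real (r ^ (2 * n)) * taylor f n) {0..2 * pi}"
    by (simp add: mult_ac)
  have 2: "of_real (r ^ (2 * n)) * (f (of_real r * cis t) / (of_real r * cis t) ^ Suc n * (of_real r * cis t))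
      = f (of_real r * cis t) * cnj ((of_real r * cis t) ^ n)" for t
  proof -
    define \<zeta> where "\<zeta> = of_real r * cis t"
    note c = cnj_on_circle[OF r(1) \<zeta>_def]
    have "cnj (\<zeta> ^ n) = of_real (r ^ (2 * n)) / \<zeta> ^ n"
      using c(1) by (simp add: power_mult power_divide)
    then have "of_real (r ^ (2 * n)) * (f \<zeta> / \<zeta> ^ Suc n * \<zeta>) = f \<zeta> * cnj (\<zeta> ^ n)"
      using c(2) by (simp add: field_simps)
    then show ?thesis by (simp add: \<zeta>_def)
  qed
  show ?thesis using 1 unfolding 2 .
qed

lemma taylor_sums:
  assumes f: "f holomorphic_on unit_disc" and w: "cmod w < 1"
  shows "(\<lambda>n. taylor f n * w ^ n) sums f w"
  using holomorphic_power_series[OF f, of w] w by (simp add: taylor_def)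

lemma taylor_abs_summable:
  assumes f: "f holomorphic_on unit_disc" and w: "cmod w < 1"
  shows "summable (\<lambda>n. cmod (taylor f n * w ^ n))"
proof -
  obtain \<rho> where \<rho>: "cmod w < \<rho>" "\<rho> < 1" using dense[OF w] by blast
  have "0 \<le> \<rho>" using \<rho>(1) norm_ge_zero[of w] by linarith
  then have "cmod (of_real \<rho>) < 1" using \<rho>(2) by simp
  then have "summable (\<lambda>n. taylor f n * of_real \<rho> ^ n)"
    using taylor_sums[OF f] sums_summable by blast
  then show ?thesis
    by (rule powser_insidea) (use \<rho> \<open>0 \<le> \<rho>\<close> in simp)
qed

text \<open>Parseval's identity. Expanding only \<open>g\<close> is enough, as the coefficients of \<open>f\<close> then appear as its
  Cauchy integrals.\<close>
lemma circle_inner_taylor_sums: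
  assumes f: "f holomorphic_on unit_disc" and g: "g holomorphic_on unit_disc"
    and r: "0 < r" "r < 1"
  shows "(\<lambda>n. taylor f n * cnj (taylor g n) * of_real (r ^ (2 * n))) sums circle_inner r f g"
proof -
  define c where "c t = complex_of_real r * cis t" for t
  have cr: "cmod (c t) = r" for t using r by (simp add: c_def norm_mult)
  have contf: "continuous_on {0..2*pi} (\<lambda>t. f (c t))"
    unfolding c_def by (intro continuous_on_circle holomorphic_on_imp_continuous_on f r)
  then have "compact ((\<lambda>t. f (c t)) ` {0..2*pi})"
    by (intro compact_continuous_image) auto
  then obtain M where M: "\<And>t. t \<in> {0..2*pi} \<Longrightarrow> cmod (f (c t)) \<le> M"
    by (meson bounded_iff compact_imp_bounded imageI)
  \<comment> \<open>the Weierstrass test on the circle justifies integrating the series of \<open>g\<close> term by term\<close>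
  have u: "uniform_limit {0..2*pi} (\<lambda>N t. \<Sum>n<N. f (c t) * cnj (taylor g n * c t ^ n))
      (\<lambda>t. \<Sum>n. f (c t) * cnj (taylor g n * c t ^ n)) sequentially"
  proof (rule Weierstrass_m_test)
    show "norm (f (c t) * cnj (taylor g n * c t ^ n)) \<le> M * cmod (taylor g n * of_real r ^ n)"
      if "t \<in> {0..2*pi}" for n t
      using M[OF that] r by (simp add: norm_mult norm_power cr mult_right_mono)
    show "summable (\<lambda>n. M * cmod (taylor g n * of_real r ^ n))"
      by (intro summable_mult taylor_abs_summable g) (use r in auto)
  qed
  have lim: "(\<Sum>n. f (c t) * cnj (taylor g n * c t ^ n)) = f (c t) * cnj (g (c t))" for t
    using taylor_sums[OF g, of "c t"] cr[of t] r
    by (metis sums_cnj sums_mult sums_unique)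
  have cont: "continuous_on {0..2*pi} (\<lambda>t. \<Sum>n<N. f (c t) * cnj (taylor g n * c t ^ n))" for N
    by (intro continuous_intros contf) (auto simp: c_def intro!: continuous_intros)
  obtain I J where I: "\<And>N. ((\<lambda>t. \<Sum>n<N. f (c t) * cnj (taylor g n * c t ^ n)) has_integral I N) {0..2*pi}"
    and J: "((\<lambda>t. f (c t) * cnj (g (c t))) has_integral J) {0..2*pi}" and IJ: "I \<longlonglongrightarrow> J"
    using uniform_limit_integral[OF u cont] unfolding lim by auto
  have trm: "((\<lambda>t. f (c t) * cnj (taylor g n * c t ^ n)) has_integral
      2 * of_real pi * (taylor f n * cnj (taylor g n) * of_real (r ^ (2 * n)))) {0..2*pi}" for n
    using has_integral_mult_right[OF circle_inner_monomial[OF f r, of n], of "cnj (taylor g n)"]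
    by (simp add: c_def mult_ac)
  have IN: "I N = (\<Sum>n<N. 2 * of_real pi * (taylor f n * cnj (taylor g n) * of_real (r ^ (2 * n))))" for N
    by (rule has_integral_unique[OF I]) (intro has_integral_sum finite_lessThan trm)
  have "(\<lambda>n. 2 * of_real pi * (taylor f n * cnj (taylor g n) * of_real (r ^ (2 * n)))) sums J"
    unfolding sums_def using IJ unfolding IN[abs_def] .
  from sums_mult[OF this, of "1 / (2 * of_real pi)"]
  have "(\<lambda>n. taylor f n * cnj (taylor g n) * of_real (r ^ (2 * n))) sums (J / (2 * of_real pi))"
    by (simp add: field_simps)
  moreover have "circle_inner r f g = J / (2 * of_real pi)"
    using J by (simp add: circle_inner_def integral_unique c_def)
  ultimately show ?thesis by simp
qed

lemma circle_inner_self: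
  assumes f: "continuous_on unit_disc f" and r: "0 < r" "r < 1"
  shows "circle_inner r f f = of_real (1 / (2 * pi) * integral {0..2*pi} (\<lambda>t. (cmod (f (of_real r * cis t)))\<^sup>2))"
proof -
  let ?q = "\<lambda>t. (cmod (f (of_real r * cis t)))\<^sup>2"
  have "?q integrable_on {0..2*pi}"
    by (intro integrable_continuous_real continuous_intros continuous_on_circle f r)
  then have "((\<lambda>t. complex_of_real (?q t)) has_integral of_real (integral {0..2*pi} ?q)) {0..2*pi}"
    by (intro has_integral_of_real integrable_integral)
  then have "integral {0..2 * pi} (\<lambda>t. f (of_real r * cis t) * cnj (f (of_real r * cis t)))
     = of_real (integral {0..2*pi} ?q)"
    by (simp only: complex_norm_square integral_unique)
  then show ?thesis by (simp add: circle_inner_def)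
qed

lemma hardy2_norm_bound:
  assumes "f \<in> hardy2"
  obtains M where "M \<ge> 0" "\<And>r. 0 < r \<Longrightarrow> r < 1 \<Longrightarrow> Re (circle_inner r f f) \<le> M"
proof -
  have f: "continuous_on unit_disc f"
    using assms by (simp add: hardy2_def holomorphic_on_imp_continuous_on)
  from assms obtain K where K: "\<And>r. 0 < r \<Longrightarrow> r < 1 \<Longrightarrow>
      sqrt (1 / (2 * pi) * integral {0..2 * pi} (\<lambda>t. (cmod (f (of_real r * cis t)))\<^sup>2)) \<le> K"
    unfolding hardy2_def bdd_above_def image_iff by fastforce
  show thesis
  proof
    show "Re (circle_inner r f f) \<le> K\<^sup>2" if "0 < r" "r < 1" for r
    proof -
      have "sqrt (Re (circle_inner r f f)) \<le> K"
        using K[OF that] by (simp only: circle_inner_self[OF f that] Re_complex_of_real)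
      then show ?thesis
        by (metis real_sqrt_le_iff real_sqrt_abs abs_ge_self order_trans)
    qed
  qed auto
qed

lemma hardy2_taylor_square_summable:
  assumes "f \<in> hardy2"
  shows "summable (\<lambda>n. (cmod (taylor f n))\<^sup>2)"
proof -
  have f: "f holomorphic_on unit_disc" using assms by (simp add: hardy2_def)
  obtain M where M: "\<And>r. 0 < r \<Longrightarrow> r < 1 \<Longrightarrow> Re (circle_inner r f f) \<le> M"
    using hardy2_norm_bound[OF assms] by metis
  have "(\<Sum>n<N. (cmod (taylor f n))\<^sup>2) \<le> M" for N
  proof -
    have part: "(\<Sum>n<N. (cmod (taylor f n))\<^sup>2 * r ^ (2 * n)) \<le> M" if r: "0 < r" "r < 1" for r
    proof -
      have "(\<lambda>n. complex_of_real ((cmod (taylor f n))\<^sup>2 * r ^ (2 * n))) sums circle_inner r f f"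
        using circle_inner_taylor_sums[OF f f r] by (simp add: complex_norm_square[symmetric] mult_ac)
      from sums_Re[OF this] have s: "(\<lambda>n. (cmod (taylor f n))\<^sup>2 * r ^ (2 * n)) sums Re (circle_inner r f f)"
        by simp
      have "(\<Sum>n<N. (cmod (taylor f n))\<^sup>2 * r ^ (2 * n)) \<le> (\<Sum>n. (cmod (taylor f n))\<^sup>2 * r ^ (2 * n))"
        by (rule sum_le_suminf) (use s r in \<open>auto simp: sums_iff\<close>)
      then show ?thesis using s M[OF r] by (simp add: sums_iff)
    qed
    have "((\<lambda>r. \<Sum>n<N. (cmod (taylor f n))\<^sup>2 * r ^ (2 * n)) \<longlongrightarrow> (\<Sum>n<N. (cmod (taylor f n))\<^sup>2 * 1 ^ (2 * n))) (at_left 1)"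
      by (intro tendsto_intros)
    then have "(\<Sum>n<N. (cmod (taylor f n))\<^sup>2 * 1 ^ (2 * n)) \<le> M"
    proof (rule tendsto_upperbound)
      show "\<forall>\<^sub>F r in at_left 1. (\<Sum>n<N. (cmod (taylor f n))\<^sup>2 * r ^ (2 * n)) \<le> M"
        using eventually_at_left_real[of 0 "1::real"] by (rule eventually_mono) (use part in auto)
    qed simp
    then show ?thesis by simp
  qed
  then show ?thesis
    by (intro summableI_nonneg_bounded) auto
qed

text \<open>The inner product is defined as a limit, so orthogonality carries information only once the limit is
  known to exist. By Parseval's identity the circle means form a power series in \<open>r\<^sup>2\<close> whose
  coefficients are absolutely summable, hence are continuous up to \<open>r = 1\<close>.\<close>
lemma hardy2_inner_tendsto:
  assumes f: "f \<in> hardy2" and g: "g \<in> hardy2"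
  shows "((\<lambda>r. circle_inner r f g) \<longlongrightarrow> hardy2_inner f g) (at_left 1)"
proof -
  define s where "s r = (\<Sum>n. taylor f n * cnj (taylor g n) * of_real (r ^ (2 * n)))" for r :: real
  have sumg: "summable (\<lambda>n. (cmod (taylor f n))\<^sup>2 + (cmod (taylor g n))\<^sup>2)"
    by (intro summable_add hardy2_taylor_square_summable f g)
  have "uniform_limit {0..1} (\<lambda>N r. \<Sum>n<N. taylor f n * cnj (taylor g n) * of_real (r ^ (2 * n))) s sequentially"
    unfolding s_def
  proof (rule Weierstrass_m_test[OF _ sumg])
    show "norm (taylor f n * cnj (taylor g n) * of_real (r ^ (2 * n)))
        \<le> (cmod (taylor f n))\<^sup>2 + (cmod (taylor g n))\<^sup>2" if "r \<in> {0..1}" for n and r :: real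
    proof -
      have "norm (taylor f n * cnj (taylor g n) * of_real (r ^ (2 * n)))
          \<le> cmod (taylor f n) * cmod (taylor g n)"
        using that by (simp add: norm_mult norm_power mult_left_le power_le_one)
      also have "\<dots> \<le> (cmod (taylor f n))\<^sup>2 + (cmod (taylor g n))\<^sup>2"
        using sum_squares_bound[of "cmod (taylor f n)" "cmod (taylor g n)"]
          mult_nonneg_nonneg[OF norm_ge_zero norm_ge_zero, of "taylor f n" "taylor g n"]
        by linarith
      finally show ?thesis .
    qed
  qed
  then have "continuous_on {0..1} s"
    by (rule uniform_limit_theorem[rotated]) (auto intro!: always_eventually continuous_intros)
  then have "(s \<longlongrightarrow> s 1) (at 1 within {0..1})"
    by (auto simp: continuous_on_def)
  then have "(s \<longlongrightarrow> s 1) (at_left 1)"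
    by (simp add: at_within_Icc_at_left)
  moreover have "\<forall>\<^sub>F r in at_left 1. s r = circle_inner r f g"
    using eventually_at_left_real[of 0 "1::real"]
  proof (rule eventually_mono)
    fix r :: real assume "r \<in> {0<..<1}"
    then show "s r = circle_inner r f g"
      using circle_inner_taylor_sums[of f g r] f g by (simp add: s_def hardy2_def sums_iff)
  qed simp
  ultimately have *: "((\<lambda>r. circle_inner r f g) \<longlongrightarrow> s 1) (at_left 1)"
    by (rule Lim_transform_eventually)
  then have "hardy2_inner f g = s 1"
    unfolding hardy2_inner_def by (intro tendsto_Lim) (auto simp: circle_inner_def)
  with * show ?thesis by simp
qed

lemma bounded_holomorphic_in_hardy2:
  assumes f: "f holomorphic_on unit_disc" and b: "\<And>z. cmod z < 1 \<Longrightarrow> cmod (f z) \<le> b"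
  shows "f \<in> hardy2"
proof -
  have "sqrt (1 / (2 * pi) * integral {0..2 * pi} (\<lambda>t. (cmod (f (of_real r * cis t)))\<^sup>2)) \<le> sqrt (b\<^sup>2)"
    if r: "0 < r" "r < 1" for r
  proof -
    have "integral {0..2 * pi} (\<lambda>t. (cmod (f (of_real r * cis t)))\<^sup>2) \<le> integral {0..2*pi} (\<lambda>t. b\<^sup>2)"
    proof (rule integral_le)
      show "(\<lambda>t. (cmod (f (of_real r * cis t)))\<^sup>2) integrable_on {0..2 * pi}"
        by (intro integrable_continuous_real continuous_intros continuous_on_circle
             holomorphic_on_imp_continuous_on f r)
      show "(cmod (f (of_real r * cis t)))\<^sup>2 \<le> b\<^sup>2" for t
        using b[of "of_real r * cis t"] r by (intro power_mono) (auto simp: norm_mult)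
    qed auto
    then have "1 / (2 * pi) * integral {0..2 * pi} (\<lambda>t. (cmod (f (of_real r * cis t)))\<^sup>2) \<le> b\<^sup>2"
      by (simp add: field_simps)
    then show ?thesis by (rule real_sqrt_le_mono)
  qed
  then have "bdd_above ((\<lambda>r::real. sqrt (1 / (2 * pi) *
      integral {0..2 * pi} (\<lambda>t. (cmod (f (of_real r * cis t)))\<^sup>2))) ` {0<..<1})"
    by (intro bdd_aboveI2) auto
  then show ?thesis
    using f by (simp add: hardy2_def)
qed

section \<open>Increments of functions in the model space\<close>

lemma circle_inner_integrable:
  assumes "continuous_on unit_disc f" "continuous_on unit_disc g" "0 < r" "r < 1"
  shows "(\<lambda>t. f (of_real r * cis t) * cnj (g (of_real r * cis t))) integrable_on {0..2 * pi}"
  by (intro integrable_continuous_real continuous_intros continuous_on_circle assms)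

lemma circle_inner_diff_right:
  assumes "continuous_on unit_disc f" "continuous_on unit_disc g" "continuous_on unit_disc h" "0 < r" "r < 1"
  shows "circle_inner r f (\<lambda>z. g z - h z) = circle_inner r f g - circle_inner r f h"
  unfolding circle_inner_def complex_cnj_diff right_diff_distrib
  by (subst integral_diff) (intro circle_inner_integrable assms, intro circle_inner_integrable assms, simp add: right_diff_distrib)

lemma circle_inner_diff_left:
  assumes "continuous_on unit_disc f" "continuous_on unit_disc g" "continuous_on unit_disc h" "0 < r" "r < 1"
  shows "circle_inner r (\<lambda>z. f z - g z) h = circle_inner r f h - circle_inner r g h"
  unfolding circle_inner_def left_diff_distrib
  by (subst integral_diff) (intro circle_inner_integrable assms, intro circle_inner_integrable assms, simp add: right_diff_distrib)

lemma circle_inner_scale_right: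
  "circle_inner r f (\<lambda>z. c * g z) = cnj c * circle_inner r f g"
proof -
  have "integral {0..2 * pi} (\<lambda>t. f (of_real r * cis t) * cnj (c * g (of_real r * cis t)))
      = integral {0..2 * pi} (\<lambda>t. cnj c * (f (of_real r * cis t) * cnj (g (of_real r * cis t))))"
    by (simp add: mult_ac)
  then show ?thesis unfolding circle_inner_def by (simp add: mult_ac)
qed

lemma circle_inner_cnj:
  assumes "continuous_on unit_disc f" "continuous_on unit_disc g" "0 < r" "r < 1"
  shows "circle_inner r g f = cnj (circle_inner r f g)"
proof -
  have "((\<lambda>t. cnj (f (of_real r * cis t) * cnj (g (of_real r * cis t)))) has_integral
      cnj (integral {0..2*pi} (\<lambda>t. f (of_real r * cis t) * cnj (g (of_real r * cis t))))) {0..2*pi}"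
    using has_integral_linear[OF integrable_integral[OF circle_inner_integrable[OF assms]] bounded_linear_cnj]
    by (simp add: o_def)
  then show ?thesis
    by (simp add: circle_inner_def integral_unique mult.commute)
qed

text \<open>A weighted form of the Cauchy-Schwarz inequality. The weight \<open>c\<close> is chosen later; in this form the
  inequality is stable under the passage to the limit.\<close>
lemma circle_inner_amgm:
  assumes f: "continuous_on unit_disc f" and g: "continuous_on unit_disc g"
    and r: "0 < r" "r < 1" and c: "c > 0"
  shows "2 * cmod (circle_inner r f g) \<le> c * Re (circle_inner r f f) + Re (circle_inner r g g) / c"
proof -
  let ?F = "\<lambda>t. (cmod (f (of_real r * cis t)))\<^sup>2" and ?G = "\<lambda>t. (cmod (g (of_real r * cis t)))\<^sup>2"
  let ?h = "\<lambda>t. c / 2 * ?F t + 1 / (2 * c) * ?G t"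
  have F: "?F integrable_on {0..2*pi}" and G: "?G integrable_on {0..2*pi}"
    by (intro integrable_continuous_real continuous_intros continuous_on_circle f g r)+
  have "cmod (integral {0..2*pi} (\<lambda>t. f (of_real r * cis t) * cnj (g (of_real r * cis t))))
     \<le> integral {0..2*pi} ?h"
  proof (rule integral_norm_bound_integral)
    show "?h integrable_on {0..2*pi}"
      by (intro integrable_add integrable_on_mult_right F G)
    show "cmod (f (of_real r * cis t) * cnj (g (of_real r * cis t))) \<le> ?h t" for t
    proof -
      let ?x = "cmod (f (of_real r * cis t))" and ?y = "cmod (g (of_real r * cis t))"
      have "0 \<le> (c * ?x - ?y)\<^sup>2" by simp
      then have "2 * c * (?x * ?y) \<le> c\<^sup>2 * ?x\<^sup>2 + ?y\<^sup>2"
        by (simp add: power2_diff power_mult_distrib mult_ac)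
      then have "?x * ?y \<le> (c\<^sup>2 * ?x\<^sup>2 + ?y\<^sup>2) / (2 * c)"
        using c by (simp add: field_simps)
      also have "\<dots> = ?h t"
        using c by (simp add: field_simps power2_eq_square)
      finally show ?thesis by (simp add: norm_mult)
    qed
  qed (intro circle_inner_integrable f g r)
  also have "\<dots> = c / 2 * integral {0..2*pi} ?F + 1 / (2 * c) * integral {0..2*pi} ?G"
    by (subst integral_add)
       (intro integrable_on_mult_right F, intro integrable_on_mult_right G, simp only: integral_mult_right)
  finally have "1 / (2 * pi) * cmod (integral {0..2*pi} (\<lambda>t. f (of_real r * cis t) * cnj (g (of_real r * cis t))))
      \<le> 1 / (2 * pi) * (c / 2 * integral {0..2*pi} ?F + 1 / (2 * c) * integral {0..2*pi} ?G)"
    by (rule mult_left_mono) simp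
  then have "cmod (circle_inner r f g)
      \<le> 1 / (2 * pi) * (c / 2 * integral {0..2*pi} ?F + 1 / (2 * c) * integral {0..2*pi} ?G)"
    unfolding circle_inner_def norm_mult norm_of_real by simp
  then show ?thesis
    unfolding circle_inner_self[OF f r] circle_inner_self[OF g r] Re_complex_of_real
    by (simp add: field_simps)
qed

text \<open>This is how \<open>\<bar>B\<bar> \<le> 1\<close> enters: the quadratic term of the expanded square is replaced by the norm of
  \<open>v\<close>. On circles inside the disc this inequality takes the place of the boundary identity \<open>\<bar>B\<bar> = 1\<close>.\<close>
lemma circle_inner_minus_contraction:
  assumes u: "continuous_on unit_disc u" and v: "continuous_on unit_disc v"
    and B: "continuous_on unit_disc B" and b: "\<And>z. cmod z < 1 \<Longrightarrow> cmod (B z) \<le> 1"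
    and r: "0 < r" "r < 1"
  shows "Re (circle_inner r (\<lambda>z. u z - B z * v z) (\<lambda>z. u z - B z * v z))
    \<le> Re (circle_inner r u u) - 2 * Re (circle_inner r (\<lambda>z. B z * v z) u) + Re (circle_inner r v v)"
proof -
  let ?h = "\<lambda>z. B z * v z"
  have h: "continuous_on unit_disc ?h" by (intro continuous_intros B v)
  have "integral {0..2*pi} (\<lambda>t. (cmod (?h (of_real r * cis t)))\<^sup>2)
      \<le> integral {0..2*pi} (\<lambda>t. (cmod (v (of_real r * cis t)))\<^sup>2)"
  proof (rule integral_le)
    show "(cmod (?h (of_real r * cis t)))\<^sup>2 \<le> (cmod (v (of_real r * cis t)))\<^sup>2" for t
      using b[of "of_real r * cis t"] r
      by (intro power_mono) (simp_all add: norm_mult mult_left_le_one_le)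
  qed (intro integrable_continuous_real continuous_intros continuous_on_circle[OF B] continuous_on_circle[OF v] r)+
  then have "Re (circle_inner r ?h ?h) \<le> Re (circle_inner r v v)"
    unfolding circle_inner_self[OF h r] circle_inner_self[OF v r] Re_complex_of_real
    by (intro mult_left_mono) auto
  moreover have "circle_inner r (\<lambda>z. u z - ?h z) (\<lambda>z. u z - ?h z)
      = circle_inner r u u - cnj (circle_inner r ?h u) - (circle_inner r ?h u - circle_inner r ?h ?h)"
    using u h r
    by (simp add: circle_inner_diff_left circle_inner_diff_right circle_inner_cnj[of ?h u]
        continuous_on_diff)
  ultimately show ?thesis by simp
qed

text \<open>For an inner function \<open>B\<close>, the reproducing kernel of its model space at the point \<open>w\<close>; it is the Szego kernel when \<open>B = 0\<close>.\<close>
definition model_kernel :: "(complex \<Rightarrow> complex) \<Rightarrow> complex \<Rightarrow> complex \<Rightarrow> complex" where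
  "model_kernel B w z = (1 - B z * cnj (B w)) / (1 - z * cnj w)"

lemma szego_holomorphic: "cmod z < 1 \<Longrightarrow> szego z holomorphic_on unit_disc"
  unfolding szego_def[abs_def]
  using one_minus_cnj_mult_nonzero[of z] by (auto intro!: holomorphic_intros)

lemma norm_szego_le:
  assumes "cmod z < 1" "cmod w < 1"
  shows "cmod (szego z w) \<le> 1 / (1 - cmod z)"
proof -
  have "1 - cmod z \<le> cmod (1 - cnj (cnj w) * cnj z)"
    using norm_one_minus_cnj_mult_ge[of "cnj w" "cnj z"] assms by simp
  then show ?thesis using assms
    unfolding szego_def norm_divide by (intro frac_le) (auto simp: mult.commute)
qed

lemma tendsto_dilate:
  assumes g: "continuous_on unit_disc g" and z: "cmod z < 1"
  shows "((\<lambda>r. g (of_real (r\<^sup>2) * z)) \<longlongrightarrow> g z) (at_left (1::real))"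
proof -
  have "isCont g z" using g z by (simp add: continuous_on_eq_continuous_at)
  then show ?thesis
  proof (rule isCont_tendsto_compose)
    have "((\<lambda>r. complex_of_real (r\<^sup>2) * z) \<longlongrightarrow> of_real (1\<^sup>2) * z) (at_left (1::real))"
      by (intro tendsto_intros)
    then show "((\<lambda>r. complex_of_real (r\<^sup>2) * z) \<longlongrightarrow> z) (at_left (1::real))" by simp
  qed
qed

text \<open>The increment \<open>f z - f w\<close> is the inner product of \<open>f\<close> with the difference \<open>u\<close> of two Szego kernels.
  As \<open>f\<close> is orthogonal to \<open>B v\<close>, it is also the inner product with \<open>u - B v\<close>, and for the right
  \<open>v\<close> this is the difference of the two kernels of the model space. Its squared norm is at most the
  bracketed expression on the right-hand side, computed with the reproducing property on circles of radius
  \<open>r\<close> and the limit \<open>r \<rightarrow> 1\<close>.\<close>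
lemma model_space_increment:
  assumes B: "B holomorphic_on unit_disc" and b: "\<And>z. cmod z < 1 \<Longrightarrow> cmod (B z) \<le> 1"
    and f: "f \<in> model_space B"
    and M: "\<And>r. 0 < r \<Longrightarrow> r < 1 \<Longrightarrow> Re (circle_inner r f f) \<le> M"
    and z: "cmod z < 1" and w: "cmod w < 1" and c: "c > 0"
  shows "2 * cmod (f z - f w) \<le> c * M + Re (model_kernel B z z - model_kernel B w z
      - model_kernel B z w + model_kernel B w w) / c"
proof -
  define u where "u x = szego z x - szego w x" for x
  define v where "v x = cnj (B z) * szego z x - cnj (B w) * szego w x" for x
  \<comment> \<open>the expanded squared norm of \<open>u - B v\<close> on the circle of radius \<open>r\<close>, with \<open>B v\<close> replaced by \<open>v\<close> in the last term\<close>
  define R where "R r = Re (u (of_real (r\<^sup>2) * z) - u (of_real (r\<^sup>2) * w))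
      - 2 * Re (B (of_real (r\<^sup>2) * z) * v (of_real (r\<^sup>2) * z) - B (of_real (r\<^sup>2) * w) * v (of_real (r\<^sup>2) * w))
      + Re (B z * v (of_real (r\<^sup>2) * z) - B w * v (of_real (r\<^sup>2) * w))" for r :: real
  have fh: "f \<in> hardy2" and fhol: "f holomorphic_on unit_disc"
    using f by (auto simp: model_space_def hardy2_def)
  have uhol: "u holomorphic_on unit_disc" and vhol: "v holomorphic_on unit_disc"
    unfolding u_def[abs_def] v_def[abs_def]
    by (intro holomorphic_intros szego_holomorphic z w)+
  have Bvhol: "(\<lambda>x. B x * v x) holomorphic_on unit_disc"
    by (intro holomorphic_intros B vhol)
  note cont = holomorphic_on_imp_continuous_on
  note szc = cont[OF szego_holomorphic[OF z]] cont[OF szego_holomorphic[OF w]]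
  \<comment> \<open>orthogonality to \<open>B v\<close> requires \<open>v\<close> in \<open>hardy2\<close>, the existence of the limit requires \<open>B v\<close> in \<open>hardy2\<close>; boundedness gives both\<close>
  have vbd: "cmod (v x) \<le> 1 / (1 - cmod z) + 1 / (1 - cmod w)" if x: "cmod x < 1" for x
  proof -
    have "cmod (v x) \<le> cmod (cnj (B z) * szego z x) + cmod (cnj (B w) * szego w x)"
      unfolding v_def by (rule norm_triangle_ineq4)
    also have "\<dots> \<le> 1 * (1 / (1 - cmod z)) + 1 * (1 / (1 - cmod w))"
      unfolding norm_mult using b[OF z] b[OF w] norm_szego_le[OF z x] norm_szego_le[OF w x]
      by (intro add_mono mult_mono) auto
    finally show ?thesis by simp
  qed
  then have vh: "v \<in> hardy2" by (intro bounded_holomorphic_in_hardy2[OF vhol])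
  have Bvh: "(\<lambda>x. B x * v x) \<in> hardy2"
  proof (rule bounded_holomorphic_in_hardy2[OF Bvhol])
    show "cmod (B x * v x) \<le> 1 * (1 / (1 - cmod z) + 1 / (1 - cmod w))" if "cmod x < 1" for x
      unfolding norm_mult using b[OF that] vbd[OF that] by (intro mult_mono) auto
  qed
  have orth: "((\<lambda>r. circle_inner r f (\<lambda>x. B x * v x)) \<longlongrightarrow> 0) (at_left 1)"
  proof -
    have "hardy2_inner f (\<lambda>x. B x * v x) = 0"
      using f vh by (auto simp: model_space_def hardy2_multiples_def)
    then show ?thesis using hardy2_inner_tendsto[OF fh Bvh] by simp
  qed
  have lim1: "((\<lambda>r. f (of_real (r\<^sup>2) * z) - f (of_real (r\<^sup>2) * w) - circle_inner r f (\<lambda>x. B x * v x))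
      \<longlongrightarrow> f z - f w - 0) (at_left 1)"
    by (intro tendsto_diff orth tendsto_dilate cont fhol z w)
  have lim2: "(R \<longlongrightarrow> Re (u z - u w) - 2 * Re (B z * v z - B w * v w) + Re (B z * v z - B w * v w)) (at_left 1)"
    unfolding R_def[abs_def]
    by (intro tendsto_intros tendsto_dilate cont uhol vhol B z w)
  have bound: "2 * cmod (f (of_real (r\<^sup>2) * z) - f (of_real (r\<^sup>2) * w) - circle_inner r f (\<lambda>x. B x * v x))
      \<le> c * M + R r / c" if r: "0 < r" "r < 1" for r
  proof -
    let ?G = "\<lambda>x. u x - B x * v x"
    have szu: "circle_inner r g u = g (of_real (r\<^sup>2) * z) - g (of_real (r\<^sup>2) * w)"
      if g: "g holomorphic_on unit_disc" for g
      unfolding u_def[abs_def] using circle_inner_diff_right[OF cont[OF g] szc r]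
      by (simp only: circle_inner_szego[OF g r z] circle_inner_szego[OF g r w])
    have szv: "circle_inner r v v = B z * v (of_real (r\<^sup>2) * z) - B w * v (of_real (r\<^sup>2) * w)"
    proof -
      have "circle_inner r v v = circle_inner r v (\<lambda>x. cnj (B z) * szego z x)
          - circle_inner r v (\<lambda>x. cnj (B w) * szego w x)"
        by (subst (2) v_def[abs_def])
           (intro circle_inner_diff_right cont vhol r holomorphic_intros szego_holomorphic z w)
      then show ?thesis
        by (simp only: circle_inner_scale_right circle_inner_szego[OF vhol r z]
            circle_inner_szego[OF vhol r w] complex_cnj_cnj)
    qed
    have "f (of_real (r\<^sup>2) * z) - f (of_real (r\<^sup>2) * w) - circle_inner r f (\<lambda>x. B x * v x)
        = circle_inner r f ?G"
      using circle_inner_diff_right[OF cont[OF fhol] cont[OF uhol] cont[OF Bvhol] r]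
      by (simp only: szu[OF fhol])
    also have "2 * cmod \<dots> \<le> c * Re (circle_inner r f f) + Re (circle_inner r ?G ?G) / c"
      by (intro circle_inner_amgm cont fhol r c holomorphic_intros uhol B vhol)
    also have "\<dots> \<le> c * M + R r / c"
    proof (intro add_mono mult_left_mono divide_right_mono)
      have "Re (circle_inner r ?G ?G) \<le> Re (circle_inner r u u)
          - 2 * Re (circle_inner r (\<lambda>x. B x * v x) u) + Re (circle_inner r v v)"
        by (intro circle_inner_minus_contraction cont uhol vhol B b r)
      then show "Re (circle_inner r ?G ?G) \<le> R r"
        unfolding szu[OF uhol] szu[OF Bvhol] szv R_def .
    qed (use M[OF r] c in auto)
    finally show ?thesis .
  qed
  have "2 * cmod (f z - f w - 0) \<le> c * M +
      (Re (u z - u w) - 2 * Re (B z * v z - B w * v w) + Re (B z * v z - B w * v w)) / c"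
  proof (rule tendsto_le)
    show "((\<lambda>r. 2 * cmod (f (of_real (r\<^sup>2) * z) - f (of_real (r\<^sup>2) * w) - circle_inner r f (\<lambda>x. B x * v x)))
        \<longlongrightarrow> 2 * cmod (f z - f w - 0)) (at_left 1)"
      by (intro tendsto_mult tendsto_const tendsto_norm lim1)
    show "((\<lambda>r. c * M + R r / c) \<longlongrightarrow> c * M +
      (Re (u z - u w) - 2 * Re (B z * v z - B w * v w) + Re (B z * v z - B w * v w)) / c) (at_left 1)"
      using c by (intro tendsto_intros lim2) auto
    show "\<forall>\<^sub>F r in at_left 1. 2 * cmod (f (of_real (r\<^sup>2) * z) - f (of_real (r\<^sup>2) * w) - circle_inner r f (\<lambda>x. B x * v x))
        \<le> c * M + R r / c"
      using eventually_at_left_real[of 0 "1::real"] by (rule eventually_mono) (use bound in auto)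
  qed simp
  moreover have "Re (u z - u w) - 2 * Re (B z * v z - B w * v w) + Re (B z * v z - B w * v w)
      = Re ((u z - B z * v z) - (u w - B w * v w))"
    by simp
  moreover have "(u z - B z * v z) - (u w - B w * v w)
      = model_kernel B z z - model_kernel B w z - model_kernel B z w + model_kernel B w w"
    by (simp add: u_def v_def szego_def model_kernel_def diff_divide_distrib mult_ac right_diff_distrib)
  ultimately show ?thesis by simp
qed

section \<open>Growth of the derivative\<close>

text \<open>The choice \<open>c = L * \<bar>z - w\<bar>\<close> balances the two terms of the hypothesis. A derivative bound follows
  that is linear in \<open>L\<close>, not quadratic, and this decides the admissible range of exponents.\<close>
lemma cmod_deriv_le_of_increment:
  assumes f: "f holomorphic_on unit_disc" and z: "cmod z < 1" and L: "L > 0"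
    and inc: "\<And>w c. cmod w < 1 \<Longrightarrow> c > 0 \<Longrightarrow>
        2 * cmod (f z - f w) \<le> c * M + q w * (cmod (z - w))\<^sup>2 / c"
    and q: "(q \<longlongrightarrow> l) (at z)" and l: "l \<le> L\<^sup>2"
  shows "cmod (deriv f z) \<le> (M + 1) / 2 * L"
proof -
  have "(f has_field_derivative deriv f z) (at z)"
    using f z by (intro holomorphic_derivI[OF f open_ball]) auto
  then have "((\<lambda>w. (f w - f z) / (w - z)) \<longlongrightarrow> deriv f z) (at z)"
    by (simp add: has_field_derivative_iff)
  then have lim: "((\<lambda>w. cmod ((f w - f z) / (w - z))) \<longlongrightarrow> cmod (deriv f z)) (at z)"
    by (rule tendsto_norm)
  have bd: "((\<lambda>w. (L * M + q w / L) / 2) \<longlongrightarrow> (L * M + l / L) / 2) (at z)"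
    using L by (intro tendsto_intros q) auto
  have "cmod (deriv f z) \<le> (L * M + l / L) / 2"
  proof (rule tendsto_le[OF _ bd lim])
    have "\<forall>\<^sub>F w in at z. w \<in> unit_disc - {z}"
      using z by (intro eventually_at_in_open) auto
    then show "\<forall>\<^sub>F w in at z. cmod ((f w - f z) / (w - z)) \<le> (L * M + q w / L) / 2"
    proof (rule eventually_mono)
      fix w assume "w \<in> unit_disc - {z}"
      then have w: "cmod w < 1" and d: "cmod (z - w) > 0" by auto
      define d where "d = cmod (z - w)"
      have "2 * cmod (f z - f w) \<le> L * d * M + q w * d\<^sup>2 / (L * d)"
        using inc[OF w, of "L * d"] L d by (simp add: d_def)
      also have "\<dots> = d * (L * M + q w / L)"
        using d L by (simp add: d_def power2_eq_square field_simps)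
      finally have "cmod (f z - f w) / d \<le> (L * M + q w / L) / 2"
        using d by (simp add: d_def field_simps)
      then show "cmod ((f w - f z) / (w - z)) \<le> (L * M + q w / L) / 2"
        by (simp add: d_def norm_divide norm_minus_commute)
    qed
  qed simp
  also have "\<dots> \<le> (L * M + L) / 2"
    using l L by (simp add: divide_le_eq power2_eq_square)
  finally show ?thesis by (simp add: algebra_simps)
qed

lemma szego_kernel_gap:
  assumes z: "cmod z < 1" and w: "cmod w < 1"
  shows "Re (model_kernel (\<lambda>_. 0) z z - model_kernel (\<lambda>_. 0) w z - model_kernel (\<lambda>_. 0) z w + model_kernel (\<lambda>_. 0) w w)
    = (1 - (cmod z)\<^sup>2 * (cmod w)\<^sup>2) / ((1 - (cmod z)\<^sup>2) * (1 - (cmod w)\<^sup>2) * (cmod (1 - z * cnj w))\<^sup>2) * (cmod (z - w))\<^sup>2"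
proof -
  define A where "A = 1 - (cmod z)\<^sup>2"
  define C where "C = 1 - (cmod w)\<^sup>2"
  define D where "D = 1 - z * cnj w"
  define \<delta> where "\<delta> = (cmod (z - w))\<^sup>2"
  have A: "A > 0" and C: "C > 0" using z w by (auto simp: A_def C_def power_less_one_iff abs_square_less_1)
  have Dn: "D \<noteq> 0"
    using one_minus_cnj_mult_nonzero[of w z] w z by (simp add: D_def mult.commute)
  have D2: "(cmod D)\<^sup>2 = A * C + \<delta>"
    unfolding D_def A_def C_def \<delta>_def cmod_power2 by (simp add: power2_eq_square algebra_simps)
  have ReD: "2 * Re D = A + C + \<delta>"
    unfolding D_def A_def C_def \<delta>_def cmod_power2 by (simp add: power2_eq_square algebra_simps)
  have D2pos: "A * C + \<delta> > 0" using D2 Dn by (metis zero_less_norm_iff zero_less_power)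
  have Kz: "model_kernel (\<lambda>_. 0) z z = of_real (1 / A)"
    by (simp add: model_kernel_def A_def of_real_cmod_square)
  have Kw: "model_kernel (\<lambda>_. 0) w w = of_real (1 / C)"
    by (simp add: model_kernel_def C_def of_real_cmod_square)
  have K1: "model_kernel (\<lambda>_. 0) w z = 1 / D" by (simp add: model_kernel_def D_def)
  have K2: "model_kernel (\<lambda>_. 0) z w = cnj (1 / D)" by (simp add: model_kernel_def D_def mult.commute)
  have Re1: "Re (1 / D) = Re D / (cmod D)\<^sup>2" by (simp add: Re_divide cmod_power2)
  have "Re (model_kernel (\<lambda>_. 0) z z - model_kernel (\<lambda>_. 0) w z - model_kernel (\<lambda>_. 0) z w + model_kernel (\<lambda>_. 0) w w)
      = 1 / A + 1 / C - 2 * Re D / (cmod D)\<^sup>2"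
    unfolding Kz Kw K1 K2 by (simp only: plus_complex.sel minus_complex.sel Re_complex_of_real cnj.sel Re1)
  also have "\<dots> = 1 / A + 1 / C - (A + C + \<delta>) / (A * C + \<delta>)"
    by (simp only: ReD D2)
  \<comment> \<open>a common denominator, using that the numerator \<open>(A + C) (A C + \<delta>) - A C (A + C + \<delta>)\<close> is divisible by \<open>\<delta>\<close>\<close>
  also have "\<dots> = (A + C - A * C) / (A * C * (A * C + \<delta>)) * \<delta>"
    using A C D2pos by (simp add: divide_simps) (simp add: algebra_simps)
  also have "A + C - A * C = 1 - (cmod z)\<^sup>2 * (cmod w)\<^sup>2"
    by (simp add: A_def C_def algebra_simps)
  also have "A * C + \<delta> = (cmod (1 - z * cnj w))\<^sup>2" using D2 by (simp add: D_def)
  finally show ?thesis by (simp only: A_def C_def \<delta>_def)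
qed

text \<open>General functions in \<open>hardy2\<close> thus fall under the increment estimate with \<open>B = 0\<close>.\<close>
lemma hardy2_subset_model_space_zero: "hardy2 \<subseteq> model_space (\<lambda>_. 0)"
  by (auto simp: model_space_def hardy2_multiples_def hardy2_inner_def intro!: tendsto_Lim)

lemma hardy2_deriv_growth:
  assumes f: "f \<in> hardy2"
    and M: "\<And>r. 0 < r \<Longrightarrow> r < 1 \<Longrightarrow> Re (circle_inner r f f) \<le> M" and z: "cmod z < 1"
  shows "cmod (deriv f z) \<le> (M + 1) / 2 * (sqrt 2 * (1 - cmod z) powr (-(3/2)))"
proof (rule cmod_deriv_le_of_increment[OF _ z])
  let ?q = "\<lambda>w. (1 - (cmod z)\<^sup>2 * (cmod w)\<^sup>2) / ((1 - (cmod z)\<^sup>2) * (1 - (cmod w)\<^sup>2) * (cmod (1 - z * cnj w))\<^sup>2)"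
  show "f holomorphic_on unit_disc" using f by (simp add: hardy2_def)
  show "0 < sqrt 2 * (1 - cmod z) powr (-(3/2))" using z by simp
  show "2 * cmod (f z - f w) \<le> c * M + ?q w * (cmod (z - w))\<^sup>2 / c" if "cmod w < 1" "c > 0" for w c
    using model_space_increment[of "\<lambda>_. 0" f M z w c] f M z that hardy2_subset_model_space_zero szego_kernel_gap[OF z that(1)]
    by auto
  have a: "0 < 1 - (cmod z)\<^sup>2" using z by (simp add: abs_square_less_1)
  have n: "cmod (1 - z * cnj z) = 1 - (cmod z)\<^sup>2"
  proof -
    have "1 - z * cnj z = of_real (1 - (cmod z)\<^sup>2)" by (simp add: of_real_cmod_square)
    then show ?thesis using a by (simp only: norm_of_real abs_of_pos)
  qed
  show "(?q \<longlongrightarrow> ?q z) (at z)"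
    using a n by (intro tendsto_intros) auto
  have "?q z = (1 + (cmod z)\<^sup>2) * (1 - (cmod z)\<^sup>2) / (1 - (cmod z)\<^sup>2) ^ 4"
    unfolding n by (simp add: algebra_simps power2_eq_square power4_eq_xxxx)
  also have "\<dots> = (1 + (cmod z)\<^sup>2) / (1 - (cmod z)\<^sup>2) ^ 3"
    using a by (simp add: power_numeral_reduce)
  also have "\<dots> \<le> 2 / (1 - cmod z) ^ 3"
  proof (rule frac_le)
    have "(cmod z)\<^sup>2 \<le> cmod z" using z by (simp add: power2_eq_square mult_left_le)
    then show "(1 - cmod z) ^ 3 \<le> (1 - (cmod z)\<^sup>2) ^ 3" using z by (intro power_mono) auto
    show "1 + (cmod z)\<^sup>2 \<le> 2" using a by simp
  qed (use z in auto)
  also have "\<dots> = (sqrt 2 * (1 - cmod z) powr (-(3/2)))\<^sup>2"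
  proof -
    have "((1 - cmod z) powr (-(3/2)))\<^sup>2 = (1 - cmod z) powr (-3)"
      by (simp add: power2_eq_square flip: powr_add)
    also have "\<dots> = 1 / (1 - cmod z) ^ 3"
      using z powr_realpow[of "1 - cmod z" 3] by (simp add: powr_minus_divide)
    finally show ?thesis by (simp add: power_mult_distrib)
  qed
  finally show "?q z \<le> (sqrt 2 * (1 - cmod z) powr (-(3/2)))\<^sup>2" .
qed

text \<open>For finite products the left-hand side is the sum of the squared increments of the Takenaka-Malmquist
  functions; their common bound carries the factors \<open>1 - \<bar>a n\<bar>\<^sup>2\<close> and is therefore uniform in the
  number of factors.\<close>
lemma blaschke_kernel_gap_le:
  assumes a: "blaschke_sequence a" and z: "cmod z < 1" and w: "cmod w < 1"
    and s: "0 < s" "\<And>n. s \<le> cmod (1 - cnj (a n) * z)"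
    and t: "0 < t" "\<And>n. t \<le> cmod (1 - cnj (a n) * w)"
  defines "S \<equiv> (\<Sum>n. 1 - (cmod (a n))\<^sup>2)" and "B \<equiv> blaschke_product a"
  shows "Re (model_kernel B z z - model_kernel B w z - model_kernel B z w + model_kernel B w w)
    \<le> S * (S / (s\<^sup>2 * t) + 1 / (s * t))\<^sup>2 * (cmod (z - w))\<^sup>2"
proof -
  have a': "0 < cmod (a n)" "cmod (a n) < 1" for n
    using a by (auto simp: blaschke_sequence_def)
  have nn: "0 \<le> 1 - (cmod (a n))\<^sup>2" for n
    using a'(2)[of n] by (simp add: power_le_one less_imp_le)
  define e where "e = takenaka_malmquist a"
  define b where "b = S / (s\<^sup>2 * t) + 1 / (s * t)"
  have K: "model_kernel (blaschke_partial a N) y x = (\<Sum>n<N. e n x * cnj (e n y))"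
    if "cmod x < 1" "cmod y < 1" for N x y
  proof -
    have "1 - x * cnj y \<noteq> 0"
      using one_minus_cnj_mult_nonzero[of y x] that by (simp add: mult.commute)
    then show ?thesis
      by (simp add: model_kernel_def e_def blaschke_partial_kernel[OF a' that])
  qed
  have lim: "(\<lambda>N. model_kernel (blaschke_partial a N) y x) \<longlonglongrightarrow> model_kernel B y x"
    if "cmod x < 1" "cmod y < 1" for x y
    unfolding model_kernel_def B_def
    using one_minus_cnj_mult_nonzero[of y x] that
    by (intro tendsto_intros blaschke_partial_tendsto a) (auto simp: mult.commute)
  have "Re (model_kernel (blaschke_partial a N) z z - model_kernel (blaschke_partial a N) w z
      - model_kernel (blaschke_partial a N) z w + model_kernel (blaschke_partial a N) w w)
      \<le> S * b\<^sup>2 * (cmod (z - w))\<^sup>2" for N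
  proof -
    have "model_kernel (blaschke_partial a N) z z - model_kernel (blaschke_partial a N) w z
      - model_kernel (blaschke_partial a N) z w + model_kernel (blaschke_partial a N) w w
      = (\<Sum>n<N. (e n z - e n w) * cnj (e n z - e n w))"
      by (simp add: K z w sum.distrib sum_subtractf algebra_simps)
    also have "\<dots> = of_real (\<Sum>n<N. (cmod (e n z - e n w))\<^sup>2)"
      by (simp only: complex_norm_square[symmetric] of_real_sum)
    finally have "Re (model_kernel (blaschke_partial a N) z z - model_kernel (blaschke_partial a N) w z
      - model_kernel (blaschke_partial a N) z w + model_kernel (blaschke_partial a N) w w)
      = (\<Sum>n<N. (cmod (e n z - e n w))\<^sup>2)"
      by (simp only: Re_complex_of_real)
    also have "\<dots> \<le> (\<Sum>n<N. (1 - (cmod (a n))\<^sup>2) * (cmod (z - w) * b)\<^sup>2)"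
    proof (rule sum_mono)
      fix n
      have "cmod (e n z - e n w) \<le> sqrt (1 - (cmod (a n))\<^sup>2) * (cmod (z - w) * b)"
        unfolding e_def b_def S_def by (rule norm_takenaka_malmquist_diff[OF a z w s t])
      then have "(cmod (e n z - e n w))\<^sup>2 \<le> (sqrt (1 - (cmod (a n))\<^sup>2) * (cmod (z - w) * b))\<^sup>2"
        by (rule power_mono) simp
      also have "\<dots> = (1 - (cmod (a n))\<^sup>2) * (cmod (z - w) * b)\<^sup>2"
        using nn by (simp add: power_mult_distrib)
      finally show "(cmod (e n z - e n w))\<^sup>2 \<le> (1 - (cmod (a n))\<^sup>2) * (cmod (z - w) * b)\<^sup>2" .
    qed
    also have "\<dots> = (\<Sum>n<N. 1 - (cmod (a n))\<^sup>2) * (cmod (z - w) * b)\<^sup>2"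
      by (simp only: sum_distrib_right)
    also have "\<dots> \<le> S * (cmod (z - w) * b)\<^sup>2"
      unfolding S_def
      by (intro mult_right_mono sum_le_suminf blaschke_sequence_square_summable[OF a] nn) auto
    finally show ?thesis by (simp add: power_mult_distrib mult_ac)
  qed
  moreover have "(\<lambda>N. Re (model_kernel (blaschke_partial a N) z z - model_kernel (blaschke_partial a N) w z
      - model_kernel (blaschke_partial a N) z w + model_kernel (blaschke_partial a N) w w)) \<longlonglongrightarrow>
      Re (model_kernel B z z - model_kernel B w z - model_kernel B z w + model_kernel B w w)"
    by (intro tendsto_intros lim z w)
  ultimately show ?thesis
    unfolding b_def by (intro LIMSEQ_le_const2) auto
qed

text \<open>A point \<open>a\<close> of the Stolz domain may be exchanged for the vertex at the cost of a constant: its distance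
  to the vertex is at most \<open>\<eta> (1 - \<bar>a\<bar>)\<close>, and \<open>1 - \<bar>a\<bar>\<close> is itself a lower bound for the kernel denominator.\<close>
lemma stolz_kernel_lower_bound:
  assumes a: "a \<in> stolz_domain \<eta> \<xi>" and \<xi>: "cmod \<xi> = 1" and \<eta>: "\<eta> \<ge> 0" and z: "cmod z < 1"
  shows "cmod (\<xi> - z) / (1 + \<eta>) \<le> cmod (1 - cnj a * z)"
proof -
  have xx: "\<xi> * cnj \<xi> = 1" using \<xi> complex_norm_square[of \<xi>] by simp
  have "\<xi> - z = \<xi> * (1 - cnj \<xi> * z)"
    using xx by (simp add: algebra_simps)
  then have e1: "cmod (\<xi> - z) = cmod (1 - cnj \<xi> * z)" by (simp add: norm_mult \<xi>)
  have "\<xi> - a = \<xi> * (1 - cnj \<xi> * a)"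
    using xx by (simp add: algebra_simps)
  then have e2: "cmod (\<xi> - a) = cmod (1 - cnj \<xi> * a)" by (simp add: norm_mult \<xi>)
  have "1 - cmod a \<le> cmod (cnj (1 - cnj a * z))"
    using norm_one_minus_cnj_mult_ge[of z a] z by (simp add: mult.commute)
  then have low: "1 - cmod a \<le> cmod (1 - cnj a * z)" by (simp only: complex_mod_cnj)
  have "1 - cnj \<xi> * z = (1 - cnj a * z) - cnj (\<xi> - a) * z" by (simp add: algebra_simps)
  then have "cmod (1 - cnj \<xi> * z) \<le> cmod (1 - cnj a * z) + cmod (cnj (\<xi> - a) * z)"
    by (metis norm_triangle_ineq4)
  also have "cmod (cnj (\<xi> - a) * z) \<le> cmod (\<xi> - a)"
    unfolding norm_mult complex_mod_cnj using z by (simp add: mult_left_le)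
  also have "\<dots> \<le> \<eta> * (1 - cmod a)" using a e2 by (simp add: stolz_domain_def)
  also have "\<dots> \<le> \<eta> * cmod (1 - cnj a * z)" using low \<eta> by (rule mult_left_mono)
  finally have "cmod (\<xi> - z) \<le> (1 + \<eta>) * cmod (1 - cnj a * z)" using e1 by (simp add: algebra_simps)
  then show ?thesis using \<eta> by (simp add: divide_le_eq mult.commute)
qed

text \<open>The exponent \<open>3\<close> comes from the increments of the Takenaka-Malmquist functions: two powers of the
  distance from the derivative of the partial product and one from the kernel.\<close>
lemma model_space_deriv_growth:
  assumes a: "blaschke_sequence a" and \<xi>: "cmod \<xi> = 1" and \<eta>: "\<eta> > 1"
    and st: "\<And>n. a n \<in> stolz_domain \<eta> \<xi>"
    and f: "f \<in> model_space (blaschke_product a)"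
    and M: "\<And>r. 0 < r \<Longrightarrow> r < 1 \<Longrightarrow> Re (circle_inner r f f) \<le> M" and z: "cmod z < 1"
  defines "S \<equiv> (\<Sum>n. 1 - (cmod (a n))\<^sup>2)"
  shows "cmod (deriv f z) \<le> (M + 1) / 2 * ((S + 1)\<^sup>2 * (1 + \<eta>) ^ 3 * cmod (\<xi> - z) powr (-3))"
proof (rule cmod_deriv_le_of_increment[OF _ z])
  let ?B = "blaschke_product a"
  define \<tau> where "\<tau> w = cmod (\<xi> - w) / (1 + \<eta>)" for w
  let ?q = "\<lambda>w. S * (S / ((\<tau> z)\<^sup>2 * \<tau> w) + 1 / (\<tau> z * \<tau> w))\<^sup>2"
  have S: "S \<ge> 0" unfolding S_def
    using a by (intro suminf_nonneg blaschke_sequence_square_summable)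
      (auto simp: blaschke_sequence_def power_le_one less_imp_le)
  have \<tau>pos: "\<tau> w > 0" if "cmod w < 1" for w
  proof -
    have "\<xi> - w \<noteq> 0" using that \<xi> by auto
    then show ?thesis using \<eta> by (simp add: \<tau>_def)
  qed
  \<comment> \<open>makes the third power of \<open>1 / \<tau> z\<close> dominate the second\<close>
  have \<tau>1: "\<tau> z \<le> 1"
  proof -
    have "cmod (\<xi> - z) \<le> 2" using norm_triangle_ineq4[of \<xi> z] \<xi> z by simp
    then show ?thesis using \<eta> by (simp add: \<tau>_def)
  qed
  show "f holomorphic_on unit_disc" using f by (simp add: model_space_def hardy2_def)
  have L: "(S + 1)\<^sup>2 * (1 + \<eta>) ^ 3 * cmod (\<xi> - z) powr (-3) = (S + 1)\<^sup>2 / \<tau> z ^ 3"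
  proof -
    have "cmod (\<xi> - z) > 0" using \<tau>pos[OF z] \<eta> by (simp add: \<tau>_def zero_less_divide_iff)
    then have "cmod (\<xi> - z) powr (-3) = 1 / cmod (\<xi> - z) ^ 3"
      using powr_realpow[of "cmod (\<xi> - z)" 3] by (simp add: powr_minus_divide)
    then show ?thesis by (simp add: \<tau>_def power_divide)
  qed
  show "0 < (S + 1)\<^sup>2 * (1 + \<eta>) ^ 3 * cmod (\<xi> - z) powr (-3)"
    unfolding L using S \<tau>pos[OF z] by simp
  show "2 * cmod (f z - f w) \<le> c * M + ?q w * (cmod (z - w))\<^sup>2 / c" if w: "cmod w < 1" and c: "c > 0" for w c
  proof -
    have "2 * cmod (f z - f w) \<le> c * M + Re (model_kernel ?B z z - model_kernel ?B w z
      - model_kernel ?B z w + model_kernel ?B w w) / c"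
      by (intro model_space_increment blaschke_product_holomorphic norm_blaschke_product_le_1 a f M z w c)
    also have "\<dots> \<le> c * M + ?q w * (cmod (z - w))\<^sup>2 / c"
      unfolding S_def
      by (intro add_left_mono divide_right_mono blaschke_kernel_gap_le a z w \<tau>pos)
        (use c \<eta> \<xi> z w in \<open>auto simp: \<tau>_def intro!: stolz_kernel_lower_bound st\<close>)
    finally show ?thesis .
  qed
  show "(?q \<longlongrightarrow> ?q z) (at z)"
  proof (intro tendsto_intros)
    show "(\<tau> \<longlongrightarrow> \<tau> z) (at z)" unfolding \<tau>_def by (intro tendsto_intros) (use \<eta> in auto)
    then show "(\<tau> \<longlongrightarrow> \<tau> z) (at z)" .
  qed (use \<tau>pos[OF z] in auto)
  have "?q z = S * (S / \<tau> z ^ 3 + 1 / (\<tau> z)\<^sup>2)\<^sup>2" by (simp add: power2_eq_square power3_eq_cube)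
  also have "\<dots> \<le> S * (S / \<tau> z ^ 3 + 1 / \<tau> z ^ 3)\<^sup>2"
    using S \<tau>pos[OF z] \<tau>1
    by (intro mult_left_mono power_mono add_mono frac_le power_decreasing) auto
  also have "\<dots> = S * (S + 1)\<^sup>2 / (\<tau> z ^ 3)\<^sup>2"
    by (simp add: add_divide_distrib[symmetric] power_divide)
  also have "\<dots> \<le> (S + 1)\<^sup>2 * (S + 1)\<^sup>2 / (\<tau> z ^ 3)\<^sup>2"
    using S by (intro divide_right_mono mult_right_mono) (auto simp: power2_eq_square algebra_simps)
  also have "\<dots> = ((S + 1)\<^sup>2 / \<tau> z ^ 3)\<^sup>2" by (simp add: power_divide power2_eq_square)
  finally show "?q z \<le> ((S + 1)\<^sup>2 * (1 + \<eta>) ^ 3 * cmod (\<xi> - z) powr (-3))\<^sup>2" unfolding L .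
qed

section \<open>Integrability of the derivative\<close>

text \<open>The fraction \<open>s / (3 * p)\<close> is the weight given to the bound at the vertex in a geometric mean of the
  two derivative bounds. Both singularities remain integrable when \<open>s < 1\<close> and
  \<open>(3 * p - s) / 2 - \<alpha> < 1\<close>, which can be met together exactly when \<open>3 * p < 3 + 2 * \<alpha>\<close>.\<close>
lemma interpolation_exponents:
  fixes p \<alpha> :: real
  assumes "\<alpha> > -1" "0 < p" "p < 1 + 2 / 3 * \<alpha>"
  obtains s u where "0 \<le> s" "s < 1" "s \<le> 3 * p" "0 \<le> u" "u < 1" "(3 * p - s) / 2 - \<alpha> \<le> u"
proof -
  define l where "l = max 0 (3 * p - 2 * \<alpha> - 2)"
  define m where "m = min 1 (3 * p)"
  \<comment> \<open>every exponent strictly between \<open>l\<close> and \<open>m\<close> is usable\<close>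
  define s where "s = (l + m) / 2"
  define u where "u = max 0 ((3 * p - s) / 2 - \<alpha>)"
  have "l < m" using assms by (simp add: l_def m_def field_simps)
  have x1: "0 \<le> l" and x2: "3 * p - 2 * \<alpha> - 2 \<le> l" and x3: "m \<le> 1" and x4: "m \<le> 3 * p"
    by (simp_all add: l_def m_def)
  have "0 \<le> s" unfolding s_def using \<open>l < m\<close> x1 by simp
  moreover have "s < 1" unfolding s_def using \<open>l < m\<close> x3 by simp
  moreover have "s \<le> 3 * p" unfolding s_def using \<open>l < m\<close> x4 by simp
  moreover have "3 * p - 2 * \<alpha> - 2 < s" unfolding s_def using \<open>l < m\<close> x2 by simp
  ultimately show thesis using that[of s u] by (auto simp: u_def field_simps)
qed

theorem theorem10:
  fixes a :: "nat \<Rightarrow> complex" and \<xi> :: complex and \<eta> \<alpha> p :: real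
    and f :: "complex \<Rightarrow> complex"
  assumes "blaschke_sequence a"
    and "cmod \<xi> = 1" and "\<eta> > 1" and "\<And>n. a n \<in> stolz_domain \<eta> \<xi>"
    and "\<alpha> > -1" and "0 < p" and "p < 1 + 2 / 3 * \<alpha>"
    and "f \<in> model_space (blaschke_product a)"
  shows "deriv f \<in> weighted_bergman p \<alpha>"
proof -
  have fh: "f \<in> hardy2" and fhol: "f holomorphic_on unit_disc"
    using assms(8) by (auto simp: model_space_def hardy2_def)
  obtain M where M0: "M \<ge> 0" and M: "\<And>r. 0 < r \<Longrightarrow> r < 1 \<Longrightarrow> Re (circle_inner r f f) \<le> M"
    using hardy2_norm_bound[OF fh] by metis
  obtain s u where s: "0 \<le> s" "s < 1" "s \<le> 3 * p" and u: "0 \<le> u" "u < 1" "(3 * p - s) / 2 - \<alpha> \<le> u"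
    using interpolation_exponents[OF assms(5,6,7)] by blast
  define C1 where "C1 = (M + 1) / 2 * sqrt 2"
  define C2 where "C2 = (M + 1) / 2 * (((\<Sum>n. 1 - (cmod (a n))\<^sup>2) + 1)\<^sup>2 * (1 + \<eta>) ^ 3)"
  have C1: "C1 \<ge> 0" and C2: "C2 \<ge> 0" using M0 assms(3) by (auto simp: C1_def C2_def)
  \<comment> \<open>the two bounds are used to the powers \<open>s / 3\<close> and \<open>p - s / 3\<close>\<close>
  define C where "C = C2 powr (s / 3) * C1 powr (p - s / 3)"
  have bound: "cmod (deriv f z) powr p * (1 - cmod z) powr \<alpha>
      \<le> C * (cmod (\<xi> - z) powr (-s) * (1 - cmod z) powr (-u))" if z: "cmod z < 1" for z
  proof -
    have b1: "cmod (deriv f z) \<le> C1 * (1 - cmod z) powr (-(3/2))"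
      using hardy2_deriv_growth[OF fh M z] by (simp add: C1_def mult_ac)
    have b2: "cmod (deriv f z) \<le> C2 * cmod (\<xi> - z) powr (-3)"
      using model_space_deriv_growth[OF assms(1,2,3,4,8) M z] by (simp add: C2_def mult_ac)
    have "cmod (deriv f z) powr p = cmod (deriv f z) powr (s / 3) * cmod (deriv f z) powr (p - s / 3)"
      by (simp flip: powr_add)
    also have "\<dots> \<le> (C2 * cmod (\<xi> - z) powr (-3)) powr (s / 3) * (C1 * (1 - cmod z) powr (-(3/2))) powr (p - s / 3)"
      using s b1 b2 by (intro mult_mono powr_mono2) auto
    also have "\<dots> = C * (cmod (\<xi> - z) powr (-s) * (1 - cmod z) powr (-((3 * p - s) / 2)))"
    proof -
      have "- (3/2) * (p - s / 3) = - ((3 * p - s) / 2)" by (simp add: field_simps)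
      then show ?thesis
        using C1 C2 by (simp only: powr_mult powr_powr C_def) simp
    qed
    finally have "cmod (deriv f z) powr p * (1 - cmod z) powr \<alpha>
      \<le> C * (cmod (\<xi> - z) powr (-s) * (1 - cmod z) powr (-((3 * p - s) / 2))) * (1 - cmod z) powr \<alpha>"
      by (rule mult_right_mono) simp
    also have "\<dots> = C * (cmod (\<xi> - z) powr (-s) * (1 - cmod z) powr (\<alpha> - (3 * p - s) / 2))"
      by (simp add: powr_add[symmetric] mult.assoc)
    also have "\<dots> \<le> C * (cmod (\<xi> - z) powr (-s) * (1 - cmod z) powr (-u))"
      using u z by (intro mult_left_mono powr_mono') (auto simp: C_def)
    finally show ?thesis .
  qed
  have "(\<integral>\<^sup>+z\<in>unit_disc. ennreal (cmod (deriv f z) powr p * (1 - cmod z) powr \<alpha>) \<partial>lborel)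
      \<le> (\<integral>\<^sup>+z. ennreal C * (ennreal (cmod (\<xi> - z) powr (-s) * (1 - cmod z) powr (-u)) * indicator unit_disc z) \<partial>lborel)"
  proof (rule nn_integral_mono)
    show "ennreal (cmod (deriv f z) powr p * (1 - cmod z) powr \<alpha>) * indicator unit_disc z
       \<le> ennreal C * (ennreal (cmod (\<xi> - z) powr (-s) * (1 - cmod z) powr (-u)) * indicator unit_disc z)" for z
      using bound[of z] by (auto simp: indicator_def C_def simp flip: ennreal_mult' intro!: ennreal_leI)
  qed
  also have "\<dots> = ennreal C * (\<integral>\<^sup>+z\<in>unit_disc. ennreal (cmod (\<xi> - z) powr (-s) * (1 - cmod z) powr (-u)) \<partial>lborel)"
  proof (rule nn_integral_cmult)
    have [measurable]: "unit_disc \<in> sets borel" by simp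
    show "(\<lambda>z. ennreal (cmod (\<xi> - z) powr (-s) * (1 - cmod z) powr (-u)) * indicator unit_disc z) \<in> borel_measurable lborel"
      by measurable
  qed
  also have "\<dots> < \<infinity>"
    using disc_integral_finite[OF s(1,2) u(1,2) assms(2)] by (simp add: ennreal_mult_less_top)
  finally have "ennreal (1 / pi) * (\<integral>\<^sup>+z\<in>unit_disc. ennreal (cmod (deriv f z) powr p * (1 - cmod z) powr \<alpha>) \<partial>lborel) < \<infinity>"
    by (simp add: ennreal_mult_less_top)
  moreover have "deriv f holomorphic_on unit_disc"
    by (intro holomorphic_deriv fhol open_ball)
  ultimately show ?thesis by (simp add: weighted_bergman_def)
qed

end
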